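(* Let $K$ be a field and let $f,g\in K(x)$ be nonconstant rational functions with a common fixed point $\alpha\in\mathbb{P}^1(\overline{K})$ such that $e_f(\alpha)$ and $e_g(\alpha)$ are both greater than $1$ and not divisible by $\mathrm{char}\,K$. If $\mathrm{Prep}(f)\neq\mathrm{Prep}(g)$, then $\langle f,g\rangle$ is a free semigroup on two generators.
   Context: For a nonconstant rational function $\varphi$ with $\varphi(\alpha)=\alpha$, $e_\varphi(\alpha)\ge1$ denotes the degree of the term of lowest positive degree in the formal power series expansion of $\varphi$ centered at $\alpha$. $\mathrm{Prep}(f)$ is the set of preperiodic points of $f$ in $\mathbb{P}^1(\overline{K})$. $\langle f,g\rangle$ is the semigroup generated under composition; free on two generators means distinct words give distinct maps. *)

theory Defs
  imports
    "HOL-Algebra.Algebraic_Closure_Type"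
    "HOL-Computational_Algebra.Computational_Algebra"
begin

type_synonym 'a ratfun = "'a poly fract"

definition rf_const :: "'a::field \<Rightarrow> 'a ratfun" where
  "rf_const c = Fract [:c:] 1"

definition rf_X :: "'a::field ratfun" where
  "rf_X = Fract [:0, 1:] 1"

definition rf_nonconstant :: "'a::field ratfun \<Rightarrow> bool" where
  "rf_nonconstant \<phi> \<longleftrightarrow> \<phi> \<notin> range rf_const"

text \<open>The lowest-terms representation with monic denominator. The library's
  \<open>quot_of_fract\<close> is not used, since it would restrict the coefficient field to the class
  \<open>field_gcd\<close>.\<close>

definition rf_quot :: "'a::field ratfun \<Rightarrow> 'a poly \<times> 'a poly" where
  "rf_quot \<phi> = (THE (p, q). \<phi> = Fract p q \<and> coprime p q \<and> lead_coeff q = 1)"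

definition rf_num :: "'a::field ratfun \<Rightarrow> 'a poly" where
  "rf_num \<phi> = fst (rf_quot \<phi>)"

definition rf_den :: "'a::field ratfun \<Rightarrow> 'a poly" where
  "rf_den \<phi> = snd (rf_quot \<phi>)"

lemma rf_quot_exists:
  fixes \<phi> :: "'a::field ratfun"
  shows "\<exists>p q. \<phi> = Fract p q \<and> coprime p q \<and> lead_coeff q = 1"
proof -
  define P where "P = (\<lambda>(p, q). q \<noteq> 0 \<and> \<phi> = Fract p q)"
  have "\<exists>x. P x"
    by (cases \<phi> rule: Fract_cases) (auto simp: P_def)
  then obtain x where x: "P x" "\<And>y. P y \<Longrightarrow> degree (snd x) \<le> degree (snd y)"
    using exists_least_iff[of "\<lambda>n. \<exists>x. P x \<and> degree (snd x) = n"]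
    by (metis (mono_tags, lifting) not_le)
  obtain p q where pq: "x = (p, q)" by force
  have q: "q \<noteq> 0" and \<phi>: "\<phi> = Fract p q" using x(1) by (auto simp: P_def pq)
  have "coprime p q"
  proof (rule coprimeI)
    fix d assume "d dvd p" "d dvd q"
    then obtain p' q' where d: "p = d * p'" "q = d * q'" by (auto elim!: dvdE)
    have "d \<noteq> 0" "q' \<noteq> 0" using q d by auto
    moreover have "\<phi> = Fract p' q'"
      using \<phi> d calculation by (simp add: eq_fract)
    ultimately have "degree q \<le> degree q'"
      using x(2)[of "(p', q')"] by (simp add: P_def pq)
    hence "degree d = 0"
      using d \<open>d \<noteq> 0\<close> \<open>q' \<noteq> 0\<close> by (simp add: degree_mult_eq)
    thus "is_unit d"
      using \<open>d \<noteq> 0\<close> by (simp add: is_unit_iff_degree)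
  qed
  moreover define c where "c = inverse (lead_coeff q)"
  have c: "c \<noteq> 0" using q by (simp add: c_def)
  ultimately have "coprime (smult c p) (smult c q)"
    by (simp add: coprime_def dvd_smult_iff)
  moreover have "\<phi> = Fract (smult c p) (smult c q)"
    using \<phi> q c by (simp add: eq_fract)
  moreover have "lead_coeff (smult c q) = 1"
    using q by (simp add: c_def)
  ultimately show ?thesis by blast
qed

lemma poly_coprime_dvd_mult:
  fixes p q r :: "'a::field poly"
  assumes "coprime p q" "q dvd p * r" "q \<noteq> 0"
  shows "q dvd r"
proof -
  define I where "I = {a * p + b * q | a b. True}"
  have "q \<in> I" unfolding I_def by (rule CollectI, rule exI[of _ 0], rule exI[of _ 1]) simp
  then obtain d where d: "d \<in> I" "d \<noteq> 0" "\<And>e. e \<in> I \<Longrightarrow> e \<noteq> 0 \<Longrightarrow> degree d \<le> degree e"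
    using exists_least_iff[of "\<lambda>n. \<exists>e. e \<in> I \<and> e \<noteq> 0 \<and> degree e = n"] assms(3)
    by (metis (mono_tags, lifting) not_le)
  obtain a b where ab: "d = a * p + b * q" using d(1) by (auto simp: I_def)
  have "d dvd u * p + v * q" for u v
  proof (rule ccontr)
    let ?e = "u * p + v * q"
    assume n: "\<not> d dvd ?e"
    hence nz: "?e mod d \<noteq> 0" by (simp add: dvd_eq_mod_eq_0)
    define k where "k = ?e div d"
    have "?e mod d = ?e - k * d"
      by (simp only: k_def minus_div_mult_eq_mod)
    also have "\<dots> = (u - k * a) * p + (v - k * b) * q"
      by (simp add: ab algebra_simps)
    finally have "?e mod d \<in> I" unfolding I_def by blast
    thus False
      using d(2,3) nz degree_mod_less' [of d ?e] by (metis not_le)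
  qed
  from this[of 1 0] this[of 0 1] have "is_unit d"
    using assms(1) by (simp add: coprime_def)
  moreover have "q dvd d * r"
    using assms(2) by (simp add: ab ring_distribs mult.assoc)
  ultimately show ?thesis
    by (simp add: dvd_mult_unit_iff')
qed

lemma rf_quot_unique:
  fixes p q p' q' :: "'a::field poly"
  assumes "Fract p q = Fract p' q'" "coprime p q" "coprime p' q'"
    and "lead_coeff q = 1" "lead_coeff q' = 1"
  shows "p = p' \<and> q = q'"
proof -
  have nz: "q \<noteq> 0" "q' \<noteq> 0" using assms by auto
  have eq: "p * q' = p' * q" using assms(1) nz by (simp add: eq_fract)
  have "q dvd p * q'" "q' dvd p' * q" using eq by (metis dvd_triv_right)+
  hence "q dvd q'" "q' dvd q"
    using assms(2,3) nz poly_coprime_dvd_mult by blast+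
  then obtain k where k: "q' = q * k" by (auto elim!: dvdE)
  have "degree q' \<le> degree q"
    using \<open>q' dvd q\<close> nz by (simp add: dvd_imp_degree_le)
  hence "degree k = 0"
    using k nz by (auto simp: degree_mult_eq)
  then obtain c where "k = [:c:]" by (rule degree_eq_zeroE)
  hence "q = q'" using k assms(4,5) by (auto simp: lead_coeff_mult split: if_splits)
  thus ?thesis using eq nz by simp
qed

lemma rf_num_den:
  shows rf_Fract_num_den: "Fract (rf_num \<phi>) (rf_den \<phi>) = \<phi>"
    and rf_coprime: "coprime (rf_num \<phi>) (rf_den \<phi>)"
    and rf_den_monic: "lead_coeff (rf_den \<phi>) = 1"
proof -
  obtain p q where pq: "\<phi> = Fract p q" "coprime p q" "lead_coeff q = 1"
    using rf_quot_exists by blast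
  have "rf_quot \<phi> = (p, q)"
    unfolding rf_quot_def
    by (rule the_equality) (use pq rf_quot_unique in \<open>auto split: prod.splits\<close>)
  thus "Fract (rf_num \<phi>) (rf_den \<phi>) = \<phi>" "coprime (rf_num \<phi>) (rf_den \<phi>)"
    "lead_coeff (rf_den \<phi>) = 1"
    using pq by (simp_all add: rf_num_def rf_den_def)
qed

definition poly_at_rf :: "'a::field poly \<Rightarrow> 'a ratfun \<Rightarrow> 'a ratfun" where
  "poly_at_rf p \<psi> = poly (map_poly rf_const p) \<psi>"

text \<open>The composition \<open>\<phi> \<circ> \<psi>\<close>. It is meaningful for nonconstant \<open>\<psi>\<close>, for which the
  denominator below is nonzero.\<close>

definition rf_comp :: "'a::field ratfun \<Rightarrow> 'a ratfun \<Rightarrow> 'a ratfun" where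
  "rf_comp \<phi> \<psi> = poly_at_rf (rf_num \<phi>) \<psi> / poly_at_rf (rf_den \<phi>) \<psi>"

datatype 'a P1 = Affine 'a | Infinity

fun rf_eval :: "'a::field ratfun \<Rightarrow> 'a P1 \<Rightarrow> 'a P1" where
  "rf_eval \<phi> (Affine z) =
     (if poly (rf_den \<phi>) z = 0 then Infinity
      else Affine (poly (rf_num \<phi>) z / poly (rf_den \<phi>) z))"
| "rf_eval \<phi> Infinity =
     (if degree (rf_num \<phi>) > degree (rf_den \<phi>) then Infinity
      else Affine (coeff (rf_num \<phi>) (degree (rf_den \<phi>)) / lead_coeff (rf_den \<phi>)))"

definition to_ac_rf :: "'a::field ratfun \<Rightarrow> 'a alg_closure ratfun" where
  "to_ac_rf \<phi> = Fract (map_poly to_ac (rf_num \<phi>)) (map_poly to_ac (rf_den \<phi>))"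

definition rf_expansion :: "'a::field ratfun \<Rightarrow> 'a \<Rightarrow> 'a fps" where
  "rf_expansion \<phi> a =
     fps_of_poly (rf_num \<phi> \<circ>\<^sub>p [:a, 1:]) / fps_of_poly (rf_den \<phi> \<circ>\<^sub>p [:a, 1:])"

definition lowest_pos_degree :: "'a::zero fps \<Rightarrow> nat" where
  "lowest_pos_degree F = (LEAST n. 0 < n \<and> fps_nth F n \<noteq> 0)"

text \<open>The number \<open>e\<^sub>\<phi>(\<alpha>)\<close> at a fixed point \<open>\<alpha>\<close> of \<open>\<phi>\<close>. At infinity, source and target
  are expanded in the local coordinate \<open>1/x\<close>, i.e. \<open>1/\<phi>(1/x)\<close> is expanded at 0.\<close>

fun rf_e :: "'a::field ratfun \<Rightarrow> 'a P1 \<Rightarrow> nat" where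
  "rf_e \<phi> (Affine a) = lowest_pos_degree (rf_expansion \<phi> a)"
| "rf_e \<phi> Infinity =
     lowest_pos_degree (rf_expansion (inverse (rf_comp \<phi> (inverse rf_X))) 0)"

definition preperiodic :: "('b \<Rightarrow> 'b) \<Rightarrow> 'b \<Rightarrow> bool" where
  "preperiodic F x \<longleftrightarrow> (\<exists>m n. m < n \<and> (F ^^ m) x = (F ^^ n) x)"

definition Prep :: "'a::field ratfun \<Rightarrow> 'a alg_closure P1 set" where
  "Prep f = {x. preperiodic (rf_eval (to_ac_rf f)) x}"

inductive_set comp_semigroup :: "'a::field ratfun \<Rightarrow> 'a ratfun \<Rightarrow> 'a ratfun set"
  for f g where
  "f \<in> comp_semigroup f g"
| "g \<in> comp_semigroup f g"
| "\<lbrakk>\<phi> \<in> comp_semigroup f g; \<psi> \<in> comp_semigroup f g\<rbrakk> \<Longrightarrow> rf_comp \<phi> \<psi> \<in> comp_semigroup f g"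

text \<open>Words in two letters are lists of booleans, \<open>True\<close> standing for \<open>f\<close> and \<open>False\<close>
  for \<open>g\<close>.\<close>

fun comp_word :: "'a::field ratfun \<Rightarrow> 'a ratfun \<Rightarrow> bool list \<Rightarrow> 'a ratfun" where
  "comp_word f g [] = rf_X"
| "comp_word f g (b # w) = rf_comp (if b then f else g) (comp_word f g w)"

definition free_comp_semigroup :: "'a::field ratfun \<Rightarrow> 'a ratfun \<Rightarrow> bool" where
  "free_comp_semigroup f g \<longleftrightarrow>
     bij_betw (comp_word f g) {w. w \<noteq> []} (comp_semigroup f g)"

end

theory Submission
  imports Defs
begin

text \<open>
  Expand \<open>f\<close> and \<open>g\<close> at the common fixed point as formal power series over the algebraic closure,
  with exponents \<open>d, e \<ge> 2\<close> that are nonzero in the field. In a formal Boettcher coordinate, \<open>f\<close> becomes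
  \<open>x\<^sup>d\<close>. If \<open>g\<close> is not a monomial there, say \<open>g = b x\<^sup>e (1 + c x\<^sup>k + \<dots>)\<close> with \<open>c \<noteq> 0\<close>, then the first
  correction term of a word occurs in relative degree exactly \<open>k\<close> if its innermost letter is \<open>g\<close>, and
  in higher degree otherwise; so words with different innermost letters differ, and by right
  cancellation there is no relation. Hence a relation forces \<open>g = b x\<^sup>e\<close>. Comparing exponents of \<open>b\<close>
  on the two sides, which amounts to the affine maps \<open>t \<mapsto> d t\<close> and \<open>t \<mapsto> e t + 1\<close> generating a free
  semigroup, shows that \<open>b\<close> is a root of unity. Since powers of \<open>d\<close> are eventually periodic modulo
  the order of \<open>b\<close>, there are \<open>a\<close> and \<open>r > 0\<close> with \<open>f\<^bsup>a+r\<^esup> g\<^sup>k = f\<^sup>a g\<^sup>k f\<^sup>r\<close> for all \<open>k\<close>. For a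
  preperiodic point of \<open>f\<close> this puts its whole \<open>g\<close>-orbit into one set \<open>{y. f\<^sup>m y = f\<^sup>n y}\<close> with \<open>m \<noteq> n\<close>,
  which is finite. So \<open>Prep f \<subseteq> Prep g\<close>, and equality follows by symmetry.
\<close>

unbundle fps_syntax

section \<open>Relations between power series\<close>

fun fps_word :: "'a::comm_ring_1 fps \<Rightarrow> 'a fps \<Rightarrow> bool list \<Rightarrow> 'a fps" where
  "fps_word A B [] = fps_X"
| "fps_word A B (b # w) = (if b then A else B) oo fps_word A B w"

lemma fps_X_oo:
  fixes T :: "'a::comm_ring_1 fps"
  assumes "T $ 0 = 0"
  shows "fps_X oo T = T"
  using assms by (auto simp: fps_X_fps_compose fps_eq_iff)

lemma fps_word_nth_0:
  assumes "A $ 0 = 0" "B $ 0 = 0"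
  shows "fps_word A B w $ 0 = 0"
  using assms by (cases w) auto

lemma fps_word_append:
  fixes A B :: "'a::idom fps"
  assumes "A $ 0 = 0" "B $ 0 = 0"
  shows "fps_word A B (u @ v) = fps_word A B u oo fps_word A B v"
proof (induction u)
  case Nil
  show ?case using assms by (simp add: fps_X_oo fps_word_nth_0)
next
  case (Cons b u)
  show ?case
    using assms by (simp add: Cons.IH fps_compose_assoc fps_word_nth_0)
qed

lemma fps_eq_X_power_mult:
  assumes "\<And>i. i < n \<Longrightarrow> f $ i = (0::'a::comm_ring_1)"
  obtains C where "f = fps_X ^ n * C"
proof
  show "f = fps_X ^ n * fps_shift n f"
    using assms by (auto simp: fps_eq_iff fps_X_power_mult_nth)
qed

text \<open>Split off the power of \<open>fps_X\<close> from \<open>F\<close>. What remains keeps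
  its nonzero constant term under composition with \<open>G\<close>, so the order comes from the
  power alone.\<close>

lemma subdegree_fps_compose:
  fixes F G :: "'a::idom fps"
  assumes "G $ 0 = 0" "G \<noteq> 0" "F \<noteq> 0"
  shows "subdegree (F oo G) = subdegree F * subdegree G"
proof -
  define U where "U = fps_shift (subdegree F) F"
  have F: "F = U * fps_X ^ subdegree F"
    unfolding U_def by (rule subdegree_decompose)
  have U0: "U $ 0 \<noteq> 0" unfolding U_def using assms(3) by simp
  hence U: "subdegree (U oo G) = 0" by (intro subdegreeI) auto
  have "F oo G = (U oo G) * G ^ subdegree F"
    by (subst F) (simp add: fps_compose_mult_distrib assms fps_X_oo flip: fps_compose_power)
  moreover have "U oo G \<noteq> 0" using U0 by (metis fps_compose_nth_0 fps_zero_nth)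
  ultimately show ?thesis using assms(2) U by simp
qed

text \<open>Removes a common suffix from a relation between words.\<close>

lemma fps_compose_right_cancel:
  fixes F G T :: "'a::idom fps"
  assumes "T $ 0 = 0" "T \<noteq> 0" "F oo T = G oo T"
  shows "F = G"
  using assms fps_compose_eq_0_iff[of T "F - G"] by (simp add: fps_compose_sub_distrib)

section \<open>A formal Boettcher coordinate\<close>

lemma fps_contraction_fixpoint:
  fixes T :: "'a::zero fps \<Rightarrow> 'a fps"
  assumes c: "\<And>A. A $ 0 = c \<Longrightarrow> T A $ 0 = c"
    and contr: "\<And>A B n. \<lbrakk>A $ 0 = c; B $ 0 = c; \<forall>i\<le>n. A $ i = B $ i\<rbrakk> \<Longrightarrow> T A $ Suc n = T B $ Suc n"
  obtains A where "A $ 0 = c" "T A = A"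
proof -
  have contr': "\<forall>i\<le>Suc n. T A $ i = T B $ i"
    if "A $ 0 = c" "B $ 0 = c" "\<forall>i\<le>n. A $ i = B $ i" for A B n
  proof (intro allI impI)
    fix i assume "i \<le> Suc n"
    show "T A $ i = T B $ i"
    proof (cases i)
      case 0
      thus ?thesis using c that by simp
    next
      case (Suc j)
      thus ?thesis using contr[of A B j] that \<open>i \<le> Suc n\<close> by simp
    qed
  qed
  define s where "s n = (T ^^ n) (Abs_fps (\<lambda>_. c))" for n
  have s_Suc: "s (Suc n) = T (s n)" for n by (simp add: s_def)
  have s0: "s n $ 0 = c" for n
    by (induction n) (simp add: s_def, simp add: s_Suc c)
  have step: "\<forall>i\<le>n. s (Suc n) $ i = s n $ i" for n
  proof (induction n)
    case 0
    show ?case by (simp add: s0)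
  next
    case (Suc n)
    thus ?case using contr'[of "s (Suc n)" "s n" n] by (simp add: s0 s_Suc)
  qed
  have stable: "s (n + m) $ i = s n $ i" if "i \<le> n" for n m i
    by (induction m) (use that step in auto)
  define A where "A = Abs_fps (\<lambda>n. s n $ n)"
  have A0: "A $ 0 = c" by (simp add: A_def s0)
  have A_s: "\<forall>i\<le>n. A $ i = s n $ i" for n
    using stable by (auto simp: A_def) (metis le_add_diff_inverse le_refl)
  have "T A $ n = A $ n" for n
  proof -
    have "T A $ n = T (s n) $ n"
      using contr'[OF A0 s0 A_s, of n] by simp
    also have "\<dots> = A $ n"
      using A_s[of "Suc n"] by (simp add: s_Suc)
    finally show ?thesis .
  qed
  hence "T A = A" by (simp add: fps_eq_iff)
  with A0 show ?thesis using that by blast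
qed

text \<open>Writing the coordinate as \<open>\<lambda> x \<psi>\<close> with \<open>\<lambda>\<^bsup>d-1\<^esup>\<close> the leading coefficient of \<open>A\<close>, the functional
  equation becomes \<open>\<psi>\<^sup>d = h \<cdot> (\<psi> \<circ> A)\<close>. Modulo lower coefficients the left-hand side contributes \<open>d \<psi>\<^sub>n\<close>
  in degree \<open>n\<close> and the right-hand side nothing, so it can be solved recursively.\<close>

lemma boettcher_coordinate:
  fixes A :: "'a::alg_closed_field fps"
  assumes d: "subdegree A = d" "d \<ge> 2" "of_nat d \<noteq> (0::'a)"
  obtains \<phi> where "\<phi> $ 0 = 0" "\<phi> $ 1 \<noteq> 0" "\<phi> oo A = \<phi> ^ d"
proof -
  have A0: "A $ 0 = 0" using d by (auto intro: nth_less_subdegree_zero)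
  have Anz: "A \<noteq> 0" using d by auto
  define a where "a = A $ d"
  have a: "a \<noteq> 0" using Anz d by (auto simp: a_def)
  define h where "h = fps_const (inverse a) * fps_shift d A"
  have A: "A = fps_const a * fps_X ^ d * h"
  proof -
    have "A = fps_X ^ d * fps_shift d A"
      using subdegree_decompose[of A] d by (simp add: mult.commute)
    also have "\<dots> = fps_const (a * inverse a) * (fps_X ^ d * fps_shift d A)" using a by simp
    also have "\<dots> = fps_const a * fps_X ^ d * h"
      unfolding h_def fps_const_mult[symmetric] by (simp only: mult_ac)
    finally show ?thesis .
  qed
  have h0: "h $ 0 = 1" using a by (simp add: h_def a_def)
  \<comment> \<open>Since \<open>d \<ge> 2\<close>, \<open>A\<close> has a factor
    \<open>fps_X ^ 2\<close>; hence \<open>A ^ Suc n\<close> has order at least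
    \<open>2 * Suc n\<close>, which exceeds \<open>Suc n\<close>.\<close>
  define A2 where "A2 = fps_const a * fps_X ^ (d - 2) * h"
  have A2: "A = fps_X ^ 2 * A2"
  proof -
    have "fps_X ^ d = fps_X ^ 2 * (fps_X ^ (d - 2) :: 'a fps)"
      using d(2) by (metis le_add_diff_inverse power_add)
    thus ?thesis by (subst A) (simp only: A2_def mult_ac)
  qed
  define T where "T \<psi> = fps_const (inverse (of_nat d)) * (h * (\<psi> oo A) - \<psi> ^ d + of_nat d * \<psi>)" for \<psi>
  have T0: "T \<psi> $ 0 = 1" if "\<psi> $ 0 = 1" for \<psi>
    using that d(3) h0 by (simp add: T_def fps_nth_power_0)
  have contr: "T P $ Suc n = T Q $ Suc n"
    if P0: "P $ 0 = 1" and Q0: "Q $ 0 = 1" and PQ: "\<forall>i\<le>n. P $ i = Q $ i" for P Q n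
  proof -
    obtain C where C: "P - Q = fps_X ^ Suc n * C"
      using fps_eq_X_power_mult[of "Suc n" "P - Q"] PQ by (auto simp: less_Suc_eq_le)
    \<comment> \<open>The cofactor of \<open>P - Q\<close> in \<open>P ^ d - Q ^ d\<close>. Its
      constant term is \<open>d\<close>, so \<open>S - of_nat d\<close> supplies the extra factor
      \<open>fps_X\<close> that makes \<open>T\<close> contract.\<close>
    define S where "S = (\<Sum>i<d. Q ^ (d - Suc i) * P ^ i)"
    have "S $ 0 = of_nat d"
      by (simp add: S_def fps_sum_nth fps_nth_power_0 P0 Q0)
    then obtain S' where S': "S - of_nat d = fps_X ^ 1 * S'"
      using fps_eq_X_power_mult[of 1 "S - of_nat d"] by (auto simp: fps_of_nat[symmetric])
    have "P ^ d - Q ^ d = (P - Q) * S"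
      unfolding S_def by (rule power_diff_sumr2)
    hence "h * ((P - Q) oo A) - (P - Q) * (S - of_nat d) =
        (h * (P oo A) - P ^ d + of_nat d * P) - (h * (Q oo A) - Q ^ d + of_nat d * Q)"
      by (simp add: fps_compose_sub_distrib algebra_simps)
    hence "T P - T Q = fps_const (inverse (of_nat d)) * (h * ((P - Q) oo A) - (P - Q) * (S - of_nat d))"
      by (simp only: T_def right_diff_distrib)
    also have "(P - Q) oo A = A ^ Suc n * (C oo A)"
      by (simp add: C fps_compose_mult_distrib A0 fps_X_oo flip: fps_compose_power del: power_Suc)
    also have "A ^ Suc n = fps_X ^ (n + 2) * (fps_X ^ n * A2 ^ Suc n)"
    proof -
      have "2 * Suc n = n + 2 + n" by simp
      thus ?thesis
        unfolding A2 power_mult_distrib by (simp only: power_mult[symmetric] power_add mult.assoc)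
    qed
    also have "fps_const (inverse (of_nat d)) * (h * (fps_X ^ (n + 2) * (fps_X ^ n * A2 ^ Suc n) * (C oo A)) - (P - Q) * (S - of_nat d))
       = fps_X ^ (n + 2) * (fps_const (inverse (of_nat d)) * (h * (fps_X ^ n * A2 ^ Suc n * (C oo A)) - C * S'))"
      unfolding C S' by (simp add: algebra_simps)
    finally have "(T P - T Q) $ Suc n = 0"
      by (simp only: fps_X_power_mult_nth) simp
    thus ?thesis by simp
  qed
  obtain \<psi> where \<psi>: "\<psi> $ 0 = 1" "T \<psi> = \<psi>"
    using fps_contraction_fixpoint[of 1 T] T0 contr by blast
  have "of_nat d * \<psi> = of_nat d * T \<psi>" by (simp add: \<psi>)
  also have "\<dots> = h * (\<psi> oo A) - \<psi> ^ d + of_nat d * \<psi>"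
    using d(3) unfolding T_def fps_of_nat[symmetric] mult.assoc[symmetric] fps_const_mult by simp
  finally have eq: "\<psi> ^ d = h * (\<psi> oo A)" by simp
  \<comment> \<open>The scalar of the coordinate: \<open>l ^ d = l * a\<close> absorbs the leading
    coefficient of \<open>A\<close>. This root needs the algebraically closed field.\<close>
  obtain l where l: "l ^ (d - 1) = a"
    using nth_root_exists[of "d - 1" a] d(2) by auto
  have l0: "l \<noteq> 0" using l a d(2) by (auto simp: power_0_left split: if_splits)
  have ld: "l ^ d = l * a" using l d(2) by (metis Suc_diff_1 gr0I not_numeral_le_zero power_Suc)
  define \<phi> where "\<phi> = fps_const l * fps_X * \<psi>"
  have "\<phi> oo A = fps_const l * A * (\<psi> oo A)"
    by (simp add: \<phi>_def fps_compose_mult_distrib A0 fps_X_oo)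
  also have "\<dots> = fps_const (l * a) * fps_X ^ d * (h * (\<psi> oo A))"
    by (subst A) (simp add: mult_ac flip: fps_const_mult)
  also have "\<dots> = \<phi> ^ d"
    by (simp add: \<phi>_def power_mult_distrib fps_const_power ld eq)
  finally have "\<phi> oo A = \<phi> ^ d" .
  moreover have "\<phi> $ 0 = 0" "\<phi> $ 1 \<noteq> 0"
    using l0 \<psi>(1) by (auto simp: \<phi>_def mult.assoc)
  ultimately show ?thesis using that by blast
qed

section \<open>The first correction term of a word\<close>

definition gap_form :: "nat \<Rightarrow> nat \<Rightarrow> 'a \<Rightarrow> 'a \<Rightarrow> 'a::comm_ring_1 fps \<Rightarrow> bool" where
  "gap_form k m c r H \<longleftrightarrow>
     (\<exists>Z. H = fps_X ^ m * (fps_const c + fps_const r * fps_X ^ k + fps_X ^ Suc k * Z))"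

text \<open>With \<open>c \<noteq> 0\<close> and \<open>k \<ge> 1\<close>, \<open>m\<close> is the
  order of \<open>H\<close> and \<open>r\<close> its coefficient in degree \<open>m + k\<close>. The
  value \<open>r = 0\<close> is allowed and records that any correction starts beyond relative
  degree \<open>k\<close>.\<close>

lemma gap_form_unique:
  assumes "gap_form k m c r H" "gap_form k m' c' r' H" "c \<noteq> 0" "c' \<noteq> 0" "k \<ge> 1"
  shows "m = m' \<and> r = r'"
proof -
  have *: "subdegree H = m \<and> H $ (m + k) = r"
    if gf: "gap_form k m c r H" "c \<noteq> 0" for m c r
  proof -
    obtain Z where H: "H = fps_X ^ m * (fps_const c + fps_const r * fps_X ^ k + fps_X ^ Suc k * Z)"
      using gf unfolding gap_form_def by blast
    have "subdegree H = m"
      using gf(2) assms(5)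
      by (intro subdegreeI) (auto simp: H fps_X_power_mult_nth simp del: power_Suc)
    moreover have "H $ (m + k) = r"
      using assms(5) by (simp add: H fps_X_power_mult_nth del: power_Suc)
    ultimately show ?thesis by simp
  qed
  show ?thesis using *[OF assms(1,3)] *[OF assms(2,4)] by auto
qed

text \<open>An unspecified remainder suffices because \<open>y ^ 2\<close> will end up in an error
  term. At \<open>m = 0\<close> the truncated \<open>m - 1\<close> is harmless, as its factor is
  zero.\<close>

lemma power_add_first_order:
  fixes u y :: "'a::comm_ring_1"
  shows "\<exists>Z. (u + y) ^ m = u ^ m + of_nat m * u ^ (m - 1) * y + y ^ 2 * Z"
proof (induction m)
  case 0
  show ?case by (rule exI[of _ 0]) simp
next
  case (Suc m)
  then obtain Z where Z: "(u + y) ^ m = u ^ m + of_nat m * u ^ (m - 1) * y + y ^ 2 * Z" by blast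
  have "(u + y) ^ Suc m = (u + y) * (u ^ m + of_nat m * u ^ (m - 1) * y + y ^ 2 * Z)"
    by (simp add: Z)
  also have "\<dots> = u ^ Suc m + of_nat (Suc m) * u ^ m * y + y ^ 2 * (of_nat m * u ^ (m - 1) + (u + y) * Z)"
    by (cases m) (simp_all add: algebra_simps power2_eq_square)
  finally show ?case by auto
qed

text \<open>The correction of the outer series acquires the factor \<open>H' ^ k\<close> of order at
  least \<open>n * k > k\<close>, so it sinks into the error term. Only the inner correction
  survives, multiplied by the derivative of \<open>c y^m\<close> at \<open>c'\<close>.\<close>

lemma gap_form_compose:
  fixes H H' :: "'a::idom fps"
  assumes H: "gap_form k m c r H" and H': "gap_form k n c' r' H'" and k: "k \<ge> 1" and n: "n \<ge> 2"
  shows "gap_form k (m * n) (c * c' ^ m) (of_nat m * c * c' ^ (m - 1) * r') (H oo H')"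
proof -
  obtain Z where Z: "H = fps_X ^ m * (fps_const c + fps_const r * fps_X ^ k + fps_X ^ Suc k * Z)"
    using H by (auto simp: gap_form_def)
  obtain Z' where Z': "H' = fps_X ^ n * (fps_const c' + fps_const r' * fps_X ^ k + fps_X ^ Suc k * Z')"
    using H' by (auto simp: gap_form_def)
  define y where "y = fps_X ^ k * (fps_const r' + fps_X * Z')"
  define V where "V = fps_const c' + y"
  have H'V: "H' = fps_X ^ n * V" by (simp add: Z' V_def y_def algebra_simps)
  have H'0: "H' $ 0 = 0" using n by (simp add: H'V)
  obtain Y where Y: "V ^ m = fps_const c' ^ m + of_nat m * fps_const c' ^ (m - 1) * y + y ^ 2 * Y"
    using power_add_first_order[of "fps_const c'" y m] by (auto simp: V_def)
  define y2 where "y2 = fps_X ^ (k - 1) * (fps_const r' + fps_X * Z') ^ 2"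
  have y2: "y ^ 2 = fps_X ^ Suc k * y2"
  proof -
    have "k * 2 = Suc k + (k - 1)" using k by simp
    thus ?thesis
      unfolding y_def y2_def power_mult_distrib
        by (simp only: power_mult[symmetric] power_add mult.assoc)
  qed
  have "k + 1 \<le> n * k"
    using k n
    by (metis Suc_eq_plus1 add_mono le_refl mult_2 mult_le_mono1 order_trans plus_1_eq_Suc)
  then obtain j where j: "n * k = Suc k + j" by (metis Suc_eq_plus1 le_Suc_ex)
  have "H oo H' = H' ^ m * (fps_const c + fps_const r * H' ^ k + H' ^ Suc k * (Z oo H'))"
    by (simp add: Z fps_compose_mult_distrib fps_compose_add_distrib H'0 fps_X_oo flip:
        fps_compose_power del: power_Suc)
  also have "\<dots> = H' ^ m * (fps_const c + H' ^ k * (fps_const r + H' * (Z oo H')))"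
    by (simp add: algebra_simps)
  also have "H' ^ k = fps_X ^ Suc k * (fps_X ^ j * V ^ k)"
    unfolding H'V power_mult_distrib by (simp only: power_mult[symmetric] j power_add mult.assoc)
  also have "H' ^ m = fps_X ^ (m * n) * V ^ m"
    by (simp add: H'V power_mult_distrib mult.commute flip: power_mult)
  also have "fps_X ^ (m * n) * V ^ m * (fps_const c + fps_X ^ Suc k * (fps_X ^ j * V ^ k) * (fps_const r + H' * (Z oo H')))
    = fps_X ^ (m * n) * (fps_const c * V ^ m + fps_X ^ Suc k * (V ^ m * (fps_X ^ j * V ^ k) * (fps_const r + H' * (Z oo H'))))"
    by (simp add: algebra_simps)
  also have "fps_const c * V ^ m = fps_const (c * c' ^ m) + fps_const (of_nat m * c * c' ^ (m - 1) * r') * fps_X ^ k +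
     fps_X ^ Suc k * (fps_const c * (of_nat m * fps_const c' ^ (m - 1) * Z' + y2 * Y))"
    unfolding Y y2
      by (simp add: y_def algebra_simps fps_const_power flip: fps_const_mult fps_of_nat)
  finally show ?thesis
    unfolding gap_form_def by (simp only: add.assoc flip: distrib_left) blast
qed

text \<open>Each outer letter multiplies the correction coefficient by a factor that is nonzero
  because \<open>d\<close> and \<open>e\<close> are nonzero in the ring. Hence its vanishing is
  decided by the innermost letter, the last of the list.\<close>

lemma gap_form_fps_word:
  fixes B :: "'a::idom fps"
  assumes B: "gap_form k e b s B" and k: "k \<ge> 1" and s: "s \<noteq> 0" and b: "b \<noteq> 0"
    and de: "d \<ge> 2" "e \<ge> 2" "of_nat d \<noteq> (0::'a)" "of_nat e \<noteq> (0::'a)"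
    and w: "w \<noteq> []"
  shows "\<exists>m c r. m \<ge> 2 \<and> c \<noteq> 0 \<and> gap_form k m c r (fps_word (fps_X ^ d) B w) \<and> (r = 0 \<longleftrightarrow> last w)"
  using w
proof (induction w rule: list_nonempty_induct)
  case (single x)
  have "gap_form k d 1 0 (fps_X ^ d :: 'a fps)"
    unfolding gap_form_def by (rule exI[of _ 0]) simp
  moreover have "\<exists>m c r. m \<ge> 2 \<and> c \<noteq> 0 \<and> gap_form k m c r B \<and> r \<noteq> 0"
    using B s b de by blast
  ultimately show ?case using de by (cases x) (auto intro!: exI[of _ d] exI[of _ "1::'a"])
next
  case (cons x w)
  obtain m c r where IH: "m \<ge> 2" "c \<noteq> 0" "gap_form k m c r (fps_word (fps_X ^ d) B w)" "r = 0 \<longleftrightarrow> last w"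
    using cons by blast
  define p where "p = (if x then d else e)"
  define q where "q = (if x then 1 else b)"
  have "\<exists>t. gap_form k p q t (if x then fps_X ^ d else B)"
  proof (cases x)
    case True
    show ?thesis unfolding gap_form_def using True by (intro exI[of _ 0]) (simp add: p_def q_def)
  qed (use B p_def q_def in auto)
  then obtain t where t: "gap_form k p q t (if x then fps_X ^ d else B)" by blast
  have pq: "p \<ge> 2" "of_nat p \<noteq> (0::'a)" "q \<noteq> 0"
    using de b by (auto simp: p_def q_def)
  have "gap_form k (p * m) (q * c ^ p) (of_nat p * q * c ^ (p - 1) * r) (fps_word (fps_X ^ d) B (x # w))"
    using gap_form_compose[OF t IH(3) k IH(1)] by simp
  moreover have "p * m \<ge> 2" using pq IH(1) by (metis le_trans mult_le_mono1 mult_2 le_add1)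
  moreover have "q * c ^ p \<noteq> 0" using pq IH(2) by simp
  moreover have "of_nat p * q * c ^ (p - 1) * r = 0 \<longleftrightarrow> last (x # w)"
    using pq IH(2,4) cons.hyps by simp
  ultimately show ?case by blast
qed

lemma fps_monomial_or_gap_form:
  fixes B :: "'a::comm_ring_1 fps"
  assumes "B \<noteq> 0"
  obtains b where "b \<noteq> 0" "B = fps_const b * fps_X ^ subdegree B"
  | k b s where "k \<ge> 1" "b \<noteq> 0" "s \<noteq> 0" "gap_form k (subdegree B) b s B"
proof -
  define U where "U = fps_shift (subdegree B) B"
  have B: "B = fps_X ^ subdegree B * U"
    using subdegree_decompose[of B] by (simp add: U_def mult.commute)
  have U0: "U $ 0 \<noteq> 0" using assms by (simp add: U_def)
  show ?thesis
  proof (cases "\<exists>i>0. U $ i \<noteq> 0")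
    case False
    hence "U = fps_const (U $ 0)" by (intro fps_ext) (metis fps_nth_fps_const gr0I)
    thus ?thesis using that(1)[OF U0] B by (metis mult.commute)
  next
    case True
    \<comment> \<open>The first relative degree in which \<open>B\<close> departs from its leading
      monomial.\<close>
    define k where "k = (LEAST i. i > 0 \<and> U $ i \<noteq> 0)"
    have k: "k > 0" "U $ k \<noteq> 0" using LeastI_ex[OF True] by (auto simp: k_def)
    have less: "U $ i = 0" if "0 < i" "i < k" for i
      using not_less_Least[of i "\<lambda>i. i > 0 \<and> U $ i \<noteq> 0"] that
        by (auto simp: k_def)
    obtain Z where "U - fps_const (U $ 0) - fps_const (U $ k) * fps_X ^ k = fps_X ^ Suc k * Z"
    proof (rule fps_eq_X_power_mult)
      fix i assume "i < Suc k"
      thus "(U - fps_const (U $ 0) - fps_const (U $ k) * fps_X ^ k) $ i = 0"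
        using less[of i] k(1) by (cases "i = 0"; cases "i = k") auto
    qed
    hence "U = fps_const (U $ 0) + fps_const (U $ k) * fps_X ^ k + fps_X ^ Suc k * Z"
      by (simp add: algebra_simps)
    hence "gap_form k (subdegree B) (U $ 0) (U $ k) B"
      unfolding gap_form_def using B by metis
    thus ?thesis using that(2)[of k] k U0 by simp
  qed
qed

section \<open>Words in two monomials\<close>

text \<open>The exponents \<open>D\<close> and \<open>N\<close> of a word \<open>b\<^sup>N x\<^sup>D\<close> in the monomials \<open>x\<^sup>d\<close> and \<open>b x\<^sup>e\<close>.\<close>

fun word_deg :: "nat \<Rightarrow> nat \<Rightarrow> bool list \<Rightarrow> nat" where
  "word_deg d e [] = 1"
| "word_deg d e (b # w) = (if b then d else e) * word_deg d e w"

fun word_exp :: "nat \<Rightarrow> nat \<Rightarrow> bool list \<Rightarrow> nat" where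
  "word_exp d e [] = 0"
| "word_exp d e (b # w) = (if b then d * word_exp d e w else Suc (e * word_exp d e w))"

lemma word_deg_append: "word_deg d e (u @ v) = word_deg d e u * word_deg d e v"
  by (induction u) auto

text \<open>Composition law of the affine maps \<open>t \<mapsto> D t + N\<close>.\<close>

lemma word_exp_append:
  "word_exp d e (u @ v) = word_deg d e u * word_exp d e v + word_exp d e u"
  by (induction u) (auto simp: algebra_simps)

lemma word_deg_replicate_True [simp]: "word_deg d e (replicate n True) = d ^ n"
  by (induction n) auto

lemma word_exp_replicate_True [simp]: "word_exp d e (replicate n True) = 0"
  by (induction n) auto

lemma word_deg_pos: "d > 0 \<Longrightarrow> e > 0 \<Longrightarrow> word_deg d e w > 0"
  by (induction w) auto

lemma fps_word_monomial:
  fixes b :: "'a::idom"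
  assumes "d > 0" "e > 0"
  shows "fps_word (fps_X ^ d) (fps_const b * fps_X ^ e) w =
           fps_const (b ^ word_exp d e w) * fps_X ^ word_deg d e w"
proof (induction w)
  case (Cons x w)
  have "(fps_const (b ^ word_exp d e w) * fps_X ^ word_deg d e w) $ 0 = 0"
    using word_deg_pos[OF assms, of w] by simp
  thus ?case
    by (cases x) (simp_all add: Cons.IH fps_compose_mult_distrib fps_X_oo power_mult_distrib fps_const_power
        mult_ac flip: fps_compose_power power_mult power_Suc)
qed auto

text \<open>For \<open>e > 1\<close> it says that \<open>t \<mapsto> D t + N\<close> does not move
  \<open>-1 / (e - 1)\<close> to the right. That point is fixed by
  \<open>t \<mapsto> e t + 1\<close> and not moved to the right by \<open>t \<mapsto> d t\<close>;
  both maps are increasing, so words inherit this.\<close>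

lemma word_exp_le: "d \<ge> 1 \<Longrightarrow> e \<ge> 1 \<Longrightarrow> (e - 1) * word_exp d e w + 1 \<le> word_deg d e w"
proof (induction w)
  case (Cons x w)
  let ?N = "word_exp d e w" and ?D = "word_deg d e w"
  have IH: "(e - 1) * ?N + 1 \<le> ?D" using Cons by simp
  show ?case
  proof (cases x)
    case True
    have "(e - 1) * (d * ?N) + 1 \<le> d * ((e - 1) * ?N + 1)"
      using Cons.prems by (simp add: distrib_left mult.left_commute)
    also have "\<dots> \<le> d * ?D" using IH by (rule mult_le_mono2)
    finally show ?thesis using True by simp
  next
    case False
    obtain e' where e': "e = Suc e'" using Cons.prems by (cases e) auto
    have "e' * Suc (e * ?N) + 1 = e * (e' * ?N + 1)" using e' by (simp add: algebra_simps)
    also have "\<dots> \<le> e * ?D" using IH e' by (intro mult_le_mono2) simp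
    finally show ?thesis using False e' by simp
  qed
qed simp

text \<open>A word in the affine maps \<open>t \<mapsto> d t\<close> and \<open>t \<mapsto> e t + 1\<close> acts as \<open>t \<mapsto> D t + N\<close>. Its inverse sends
  0 into one of two disjoint intervals depending on the last letter.\<close>

lemma word_exp_neq:
  assumes "d \<ge> 2" "e \<ge> 2"
    and "word_deg d e (u @ [True]) = word_deg d e (v @ [False])"
  shows "word_exp d e (u @ [True]) \<noteq> word_exp d e (v @ [False])"
proof
  assume N: "word_exp d e (u @ [True]) = word_exp d e (v @ [False])"
  obtain d' e' where de: "d = Suc d'" "e = Suc e'" "d' \<ge> 1" "e' \<ge> 1"
    using assms by (metis One_nat_def Suc_le_D Suc_le_mono numeral_2_eq_2)
  let ?D = "word_deg d e u" and ?D' = "word_deg d e v"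
  have D: "?D * d = ?D' * e" using assms(3) by (simp add: word_deg_append)
  \<comment> \<open>A trailing \<open>True\<close> contributes 0 to the exponent, a trailing
    \<open>False\<close> contributes \<open>?D'\<close>.\<close>
  have "?D' \<le> word_exp d e u" using N by (simp add: word_exp_append)
  hence "e' * ?D' + 1 \<le> ?D"
    using word_exp_le[of d e u] de
      by (metis add_le_mono1 diff_Suc_1 le_trans mult_le_mono2 plus_1_eq_Suc le_add1)
  hence "d * (e' * ?D' + 1) \<le> ?D' * e" using D by (metis mult.commute mult_le_mono2)
  hence "d' * e' * ?D' + d \<le> ?D'" by (simp add: de algebra_simps)
  moreover have "?D' \<le> d' * e' * ?D'" using de by (simp add: Suc_le_eq)
  ultimately show False using assms(1) by linarith
qed

section \<open>From a relation to a commutation law\<close>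

lemma power_mod_cycle:
  fixes d M :: nat
  assumes "M > 0"
  obtains a r where "r > 0" "d ^ (a + r) mod M = d ^ a mod M"
proof -
  have "\<not> inj (\<lambda>n. d ^ n mod M)"
  proof
    assume "inj (\<lambda>n. d ^ n mod M)"
    moreover have "range (\<lambda>n. d ^ n mod M) \<subseteq> {..<M}" using assms by auto
    ultimately show False
      using finite_subset infinite_UNIV_nat finite_imageD by blast
  qed
  then obtain m n where "m < n" "d ^ m mod M = d ^ n mod M"
    unfolding inj_def by (metis linorder_neqE_nat)
  thus ?thesis using that[of "n - m" m] by simp
qed

lemma power_eq_if_mod_eq:
  fixes b :: "'a::monoid_mult"
  assumes "b ^ M = 1" "x mod M = y mod M"
  shows "b ^ x = b ^ y"
proof -
  have "b ^ x = b ^ (x mod M)" for x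
    by (metis assms(1) div_mult_mod_eq mult.commute mult_1 power_add power_mult power_one)
  thus ?thesis using assms(2) by metis
qed

text \<open>Strip the longest common suffix: it is preceded by two different letters, or it exhausts
  one of the words.\<close>

lemma differing_suffix:
  assumes "u \<noteq> v"
  obtains s u' v' x y where "x \<noteq> y" "u = u' @ x # s" "v = v' @ y # s"
  | s u' x where "u = u' @ x # s" "v = s"
  | s v' x where "v = v' @ x # s" "u = s"
proof -
  have "(\<exists>s u' v' x y. x \<noteq> y \<and> u = u' @ x # s \<and> v = v' @ y # s) \<or>
        (\<exists>u' x. u = u' @ x # v) \<or> (\<exists>v' x. v = v' @ x # u)"
    using assms
  proof (induction u arbitrary: v rule: rev_induct)
    case Nil
    thus ?case by (cases v rule: rev_cases) (auto simp: neq_Nil_conv)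
  next
    case (snoc x u)
    show ?case
    proof (cases v rule: rev_cases)
      case Nil
      thus ?thesis by auto
    next
      case (snoc v' y)
      show ?thesis
      proof (cases "x = y")
        case True
        hence "u \<noteq> v'" using snoc snoc.prems by auto
        from snoc.IH[OF this] show ?thesis using True snoc by fastforce
      qed (use snoc in fastforce)
    qed
  qed
  thus ?thesis using that by blast
qed

lemma fps_word_relation_monomial:
  fixes B :: "'a::idom fps"
  assumes de: "d \<ge> 2" "e \<ge> 2" "of_nat d \<noteq> (0::'a)" "of_nat e \<noteq> (0::'a)" and e: "subdegree B = e"
    and rel: "fps_word (fps_X ^ d) B (u @ [True]) = fps_word (fps_X ^ d) B (v @ [False])"
  obtains b M where "B = fps_const b * fps_X ^ e" "M > 0" "b ^ M = 1"
proof -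
  have "B \<noteq> 0" using e de by auto
  thus ?thesis
  proof (cases rule: fps_monomial_or_gap_form)
    case (2 k b s)
    note gf = gap_form_fps_word[OF 2(4)[unfolded e] 2(1,3,2) de]
    obtain m c r where 1: "c \<noteq> 0" "gap_form k m c r (fps_word (fps_X ^ d) B (u @ [True]))" "r = 0"
      using gf[of "u @ [True]"] by auto
    obtain m' c' r' where 2: "c' \<noteq> 0" "gap_form k m' c' r' (fps_word (fps_X ^ d) B (v @ [False]))" "r' \<noteq> 0"
      using gf[of "v @ [False]"] by auto
    \<comment> \<open>The innermost letters differ, so one series would have both a zero and a
      nonzero correction coefficient.\<close>
    show ?thesis using gap_form_unique[OF 1(2) 2(2)[folded rel] 1(1) 2(1) \<open>k \<ge> 1\<close>] 1 2 by simp
  next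
    case (1 b)
    let ?N = "word_exp d e" and ?D = "word_deg d e"
    have eq: "fps_const (b ^ ?N (u @ [True])) * fps_X ^ ?D (u @ [True]) =
        fps_const (b ^ ?N (v @ [False])) * fps_X ^ ?D (v @ [False])"
      using rel fps_word_monomial[of d e b] de 1 e by simp
    have D: "?D (u @ [True]) = ?D (v @ [False])"
      using arg_cong[OF eq, of subdegree] 1(1) by (simp add: fps_X_power_subdegree)
    have N: "b ^ ?N (u @ [True]) = b ^ ?N (v @ [False])"
      using arg_cong[OF eq, of "\<lambda>F. F $ ?D (u @ [True])"] D by simp
    have root: "\<exists>M>0. b ^ M = 1" if "b ^ i = b ^ j" "i < j" for i j
    proof -
      have "b ^ i * b ^ (j - i) = b ^ i * 1"
        using that by (metis le_add_diff_inverse less_imp_le mult.right_neutral power_add)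
      thus ?thesis using 1(1) that(2) by (intro exI[of _ "j - i"]) simp
    qed
    obtain M where "M > 0" "b ^ M = 1"
      using word_exp_neq[OF de(1,2) D] root N by (metis linorder_neqE_nat)
    thus ?thesis using that 1 e by blast
  qed
qed

theorem fps_word_relation:
  fixes A B :: "'a::alg_closed_field fps"
  assumes de: "subdegree A \<ge> 2" "subdegree B \<ge> 2"
      "of_nat (subdegree A) \<noteq> (0::'a)" "of_nat (subdegree B) \<noteq> (0::'a)"
    and rel: "fps_word A B u = fps_word A B v" "u \<noteq> v"
  obtains a r where "r > 0"
    "\<And>k. fps_word A B (replicate (a + r) True @ replicate k False) =
          fps_word A B (replicate a True @ replicate k False @ replicate r True)"
proof -
  have A0: "A $ 0 = 0" and B0: "B $ 0 = 0" and nz: "A \<noteq> 0" "B \<noteq> 0"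
    using de by (auto intro: nth_less_subdegree_zero)
  \<comment> \<open>A nonempty word has order at least 2, so it is never \<open>fps_X\<close>; this
    excludes a relation in which one word is a suffix of the other.\<close>
  have sd: "fps_word A B w \<noteq> 0 \<and> subdegree (fps_word A B w) \<ge> 1 \<and> (w \<noteq> [] \<longrightarrow> subdegree (fps_word A B w) \<ge> 2)" for w
  proof (induction w)
    case (Cons x w)
    let ?C = "if x then A else B" and ?W = "fps_word A B w"
    have sub: "subdegree (?C oo ?W) = subdegree ?C * subdegree ?W"
      using Cons nz A0 B0 by (intro subdegree_fps_compose) (auto simp: fps_word_nth_0)
    also have "\<dots> \<ge> 2 * 1" using Cons de by (intro mult_le_mono) auto
    finally show ?case by auto
  qed simp
  have cancel: "fps_word A B p = fps_word A B q"
    if "fps_word A B (p @ s) = fps_word A B (q @ s)" for p q s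
    using that fps_compose_right_cancel[of "fps_word A B s"] sd[of s] A0 B0
    by (auto simp: fps_word_append fps_word_nth_0)
  have noX: "w = []" if "fps_word A B w = fps_word A B []" for w
    using sd[of w] that by (cases "w = []") (auto simp: subdegree_fps_X)
  obtain p q where pq: "fps_word A B (p @ [True]) = fps_word A B (q @ [False])"
    using rel(2)
  proof (cases rule: differing_suffix)
    case (1 s u' v' x y)
    have "fps_word A B (u' @ [x]) = fps_word A B (v' @ [y])"
      using rel(1) 1 cancel[of "u' @ [x]" s "v' @ [y]"] by simp
    thus ?thesis using that[of u' v'] that[of v' u'] 1(1) by (cases x; cases y) auto
  next
    case (2 s u' x)
    thus ?thesis using rel(1) cancel[of "u' @ [x]" s "[]"] noX by auto
  next
    case (3 s v' x)
    thus ?thesis using rel(1) cancel[of "v' @ [x]" s "[]"] noX by auto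
  qed
  define d e where "d = subdegree A" and "e = subdegree B"
  obtain \<phi> where \<phi>: "\<phi> $ 0 = 0" "\<phi> $ 1 \<noteq> 0" "\<phi> oo A = \<phi> ^ d"
    using boettcher_coordinate[of A d] de by (auto simp: d_def)
  define \<phi>' where "\<phi>' = fps_inv \<phi>"
  have inv: "\<phi>' oo \<phi> = fps_X" "\<phi> oo \<phi>' = fps_X"
    using fps_inv fps_inv_right \<phi>(1,2) by (auto simp: \<phi>'_def)
  have \<phi>'0: "\<phi>' $ 0 = 0" by (simp add: \<phi>'_def fps_inv_def)
  have \<phi>sd: "subdegree \<phi> = 1" using \<phi> by (intro subdegreeI) auto
  have \<phi>nz: "\<phi> \<noteq> 0" "\<phi>' \<noteq> 0" using inv by (auto simp: \<phi>sd)
  have \<phi>'sd: "subdegree \<phi>' = 1"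
    using subdegree_fps_compose[of \<phi>' \<phi>] \<phi>'0 \<phi>nz inv \<phi>sd by simp
  define B' where "B' = \<phi> oo B oo \<phi>'"
  have B'0: "B' $ 0 = 0" by (simp add: B'_def \<phi>)
  have B'sd: "subdegree B' = e"
  proof -
    have "\<phi> oo B \<noteq> 0" using B0 nz \<phi>nz by (simp add: fps_compose_eq_0_iff)
    thus ?thesis
      unfolding B'_def using \<phi>'0 \<phi>nz B0 nz
        by (simp add: subdegree_fps_compose \<phi>sd \<phi>'sd e_def)
  qed
  have A': "\<phi> oo A oo \<phi>' = fps_X ^ d"
    by (simp add: \<phi>(3) inv \<phi>'0 flip: fps_compose_power)
  \<comment> \<open>Conjugation is multiplicative: \<open>\<phi>' oo \<phi> = fps_X\<close> cancels
    between adjacent letters.\<close>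
  have conj: "\<phi> oo fps_word A B w oo \<phi>' = fps_word (fps_X ^ d) B' w" for w
  proof (induction w)
    case Nil
    show ?case by (simp add: inv)
  next
    case (Cons x w)
    let ?W = "fps_word A B w" and ?C = "if x then A else B"
    have W0: "?W $ 0 = 0" using A0 B0 by (simp add: fps_word_nth_0)
    have "fps_word (fps_X ^ d) B' (x # w) = (\<phi> oo ?C oo \<phi>') oo (\<phi> oo ?W oo \<phi>')"
      unfolding Cons.IH by (simp add: A' B'_def)
    also have "\<phi> oo ?W oo \<phi>' = \<phi> oo (?W oo \<phi>')"
      using W0 \<phi>'0 by (simp add: fps_compose_assoc)
    also have "(\<phi> oo ?C oo \<phi>') oo (\<phi> oo (?W oo \<phi>')) = (\<phi> oo ?C) oo ((\<phi>' oo \<phi>) oo (?W oo \<phi>'))"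
      using W0 \<phi>'0 \<phi>(1) by (simp add: fps_compose_assoc)
    also have "\<dots> = \<phi> oo (?C oo ?W) oo \<phi>'"
      using W0 \<phi>'0 A0 B0 by (simp add: inv fps_X_oo fps_compose_assoc)
    finally show ?case by simp
  qed
  have unconj: "fps_word A B p = fps_word A B q"
    if "fps_word (fps_X ^ d) B' p = fps_word (fps_X ^ d) B' q" for p q
  proof -
    have W0: "fps_word A B w $ 0 = 0" for w using A0 B0 by (simp add: fps_word_nth_0)
    have 1: "\<phi> oo fps_word A B p = \<phi> oo fps_word A B q"
      using that unfolding conj[symmetric]
        by (rule fps_compose_right_cancel[OF \<phi>'0 \<phi>nz(2)])
    have "fps_word A B w = \<phi>' oo (\<phi> oo fps_word A B w)" for w
      using W0 \<phi>(1) by (simp add: fps_compose_assoc inv fps_X_oo)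
    thus ?thesis using 1 by metis
  qed
  have "fps_word (fps_X ^ d) B' (p @ [True]) = fps_word (fps_X ^ d) B' (q @ [False])"
    by (simp only: conj[symmetric] pq)
  then obtain b M where b: "B' = fps_const b * fps_X ^ e" "M > 0" "b ^ M = 1"
    using fps_word_relation_monomial[of d e B' p q] de B'sd by (auto simp: d_def e_def)
  \<comment> \<open>\<open>d\<close> need not be coprime to \<open>M\<close>, so its powers modulo
    \<open>M\<close> may become periodic only from some exponent \<open>a\<close> on.\<close>
  obtain a r where ar: "r > 0" "d ^ (a + r) mod M = d ^ a mod M"
    using power_mod_cycle[OF b(2)] by blast
  have "fps_word A B (replicate (a + r) True @ replicate k False) =
          fps_word A B (replicate a True @ replicate k False @ replicate r True)" for k
  proof (rule unconj)
    \<comment> \<open>Both words have the same degree. Their exponents of \<open>b\<close> are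
      \<open>d ^ (a + r) * N\<close> and \<open>d ^ a * N\<close>, since trailing letters
      \<open>True\<close> add nothing.\<close>
    define N where "N = word_exp d e (replicate k False)"
    have "d ^ (a + r) * N mod M = d ^ a * N mod M" using ar(2) by (metis mod_mult_left_eq)
    hence "b ^ (d ^ (a + r) * N) = b ^ (d ^ a * N)" by (rule power_eq_if_mod_eq[OF b(3)])
    moreover have "d > 0" "e > 0" using de by (auto simp: d_def e_def)
    ultimately show "fps_word (fps_X ^ d) B' (replicate (a + r) True @ replicate k False) =
          fps_word (fps_X ^ d) B' (replicate a True @ replicate k False @ replicate r True)"
      by (simp add: b fps_word_monomial word_exp_append word_deg_append N_def power_add mult_ac)
  qed
  with ar(1) show ?thesis using that by blast
qed

section \<open>Substitution into rational functions\<close>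

text \<open>One operation serves for composition, extension of scalars and local expansion:
  \<open>t\<close> is in turn a rational function, \<open>rf_X\<close> over the closure, and a
  Laurent series.\<close>

definition rf_subst :: "('a::field \<Rightarrow> 'b::field) \<Rightarrow> 'b \<Rightarrow> 'a ratfun \<Rightarrow> 'b" where
  "rf_subst \<iota> t \<phi> = poly (map_poly \<iota> (rf_num \<phi>)) t / poly (map_poly \<iota> (rf_den \<phi>)) t"

locale field_embedding =
  fixes \<iota> :: "'a::field \<Rightarrow> 'b::field"
  assumes emb_add: "\<iota> (x + y) = \<iota> x + \<iota> y"
    and emb_mult: "\<iota> (x * y) = \<iota> x * \<iota> y"
    and emb_one: "\<iota> 1 = 1"
begin

lemma emb_zero [simp]: "\<iota> 0 = 0"
  by (metis add_0 add_cancel_right_left emb_add)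

lemma emb_eq_0_iff [simp]: "\<iota> x = 0 \<longleftrightarrow> x = 0"
  using emb_mult[of x "inverse x"] emb_one by (cases "x = 0") auto

lemma emb_uminus: "\<iota> (- x) = - \<iota> x"
  using emb_add[of x "- x"] by (simp add: eq_neg_iff_add_eq_0 add.commute)

lemma inj_emb: "inj \<iota>"
proof (rule injI)
  fix x y assume "\<iota> x = \<iota> y"
  hence "\<iota> (x + - y) = 0" by (simp only: emb_add emb_uminus) simp
  thus "x = y" by simp
qed

lemma poly_map_emb_add:
  "poly (map_poly \<iota> (p + q)) t = poly (map_poly \<iota> p) t + poly (map_poly \<iota> q) t"
  by (induction p q rule: poly_induct2) (simp_all add: emb_add algebra_simps map_poly_pCons)

lemma poly_map_emb_smult: "poly (map_poly \<iota> (smult c p)) t = \<iota> c * poly (map_poly \<iota> p) t"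
  by (induction p) (simp_all add: emb_mult algebra_simps map_poly_pCons)

lemma poly_map_emb_mult:
  "poly (map_poly \<iota> (p * q)) t = poly (map_poly \<iota> p) t * poly (map_poly \<iota> q) t"
  by (induction p) (simp_all add: poly_map_emb_add poly_map_emb_smult algebra_simps map_poly_pCons)

end

lemma map_poly_o: "f 0 = 0 \<Longrightarrow> g 0 = 0 \<Longrightarrow> map_poly (f \<circ> g) p = map_poly f (map_poly g p)"
  by (simp add: poly_eq_iff coeff_map_poly)

lemma rf_den_nonzero [simp]: "rf_den \<phi> \<noteq> 0"
  using rf_den_monic[of \<phi>] by auto

text \<open>Transcendence of \<open>t\<close> over the image of \<open>\<iota>\<close> keeps
  denominators nonzero, so that substitution is a field embedding.\<close>

locale rf_substitution = field_embedding +
  fixes t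
  assumes transcendental: "p \<noteq> 0 \<Longrightarrow> poly (map_poly \<iota> p) t \<noteq> 0"
begin

lemma rf_subst_Fract:
  assumes "q \<noteq> 0"
  shows "rf_subst \<iota> t (Fract p q) = poly (map_poly \<iota> p) t / poly (map_poly \<iota> q) t"
proof -
  let ?n = "rf_num (Fract p q)" and ?d = "rf_den (Fract p q)"
  have "?n * q = p * ?d"
    using rf_Fract_num_den[of "Fract p q"] assms by (simp add: eq_fract)
  hence "poly (map_poly \<iota> ?n) t * poly (map_poly \<iota> q) t = poly (map_poly \<iota> p) t * poly (map_poly \<iota> ?d) t"
    by (metis poly_map_emb_mult)
  thus ?thesis using transcendental assms by (simp add: rf_subst_def frac_eq_eq)
qed

lemma rf_subst_const [simp]: "rf_subst \<iota> t (rf_const c) = \<iota> c"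
  by (simp add: rf_const_def rf_subst_Fract map_poly_pCons emb_one map_poly_1')

lemma rf_subst_X [simp]: "rf_subst \<iota> t rf_X = t"
  by (simp add: rf_X_def rf_subst_Fract map_poly_pCons emb_one map_poly_1')

lemma rf_subst_0 [simp]: "rf_subst \<iota> t 0 = 0"
  by (simp add: Zero_fract_def rf_subst_Fract)

lemma rf_subst_add: "rf_subst \<iota> t (\<phi> + \<psi>) = rf_subst \<iota> t \<phi> + rf_subst \<iota> t \<psi>"
  by (cases \<phi>; cases \<psi>)
     (simp add: rf_subst_Fract poly_map_emb_add poly_map_emb_mult transcendental add_frac_eq)

lemma rf_subst_mult: "rf_subst \<iota> t (\<phi> * \<psi>) = rf_subst \<iota> t \<phi> * rf_subst \<iota> t \<psi>"
  by (cases \<phi>; cases \<psi>) (simp add: rf_subst_Fract poly_map_emb_mult)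

lemma rf_subst_inverse: "rf_subst \<iota> t (inverse \<phi>) = inverse (rf_subst \<iota> t \<phi>)"
proof (cases \<phi>)
  case (Fract p q)
  thus ?thesis by (cases "p = 0") (simp_all add: rf_subst_Fract fract_collapse)
qed

lemma rf_subst_divide: "rf_subst \<iota> t (\<phi> / \<psi>) = rf_subst \<iota> t \<phi> / rf_subst \<iota> t \<psi>"
  by (simp add: divide_inverse rf_subst_mult rf_subst_inverse)

text \<open>Injectivity comes with it; this later gives right cancellation of composition and shows
  that a local expansion determines its rational function.\<close>

lemma field_embedding_rf_subst: "field_embedding (rf_subst \<iota> t)"
  using rf_subst_const[of 1] emb_one
  by unfold_locales (auto simp: rf_subst_add rf_subst_mult rf_const_def One_fract_def one_pCons)

lemma inj_rf_subst: "inj (rf_subst \<iota> t)"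
  by (rule field_embedding.inj_emb[OF field_embedding_rf_subst])

lemma rf_subst_poly:
  "rf_subst \<iota> t (poly (map_poly rf_const p) \<psi>) = poly (map_poly \<iota> p) (rf_subst \<iota> t \<psi>)"
proof (induction p)
  case (pCons c p)
  moreover have "rf_const 0 = (0 :: 'a ratfun)" by (simp add: rf_const_def fract_collapse)
  ultimately show ?case
    by (simp add: map_poly_pCons rf_subst_add rf_subst_mult)
qed simp

text \<open>The common source of associativity and of the compatibility of composition with scalar
  extension, evaluation and local expansion.\<close>

lemma rf_subst_rf_comp: "rf_subst \<iota> t (rf_comp \<phi> \<psi>) = rf_subst \<iota> (rf_subst \<iota> t \<psi>) \<phi>"
  by (simp add: rf_comp_def poly_at_rf_def rf_subst_divide rf_subst_poly rf_subst_def[of _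
      "rf_subst \<iota> t \<psi>"])

end

section \<open>Embeddings, scalar extension and transcendence\<close>

lemma rf_comp_eq_rf_subst: "rf_comp \<phi> \<psi> = rf_subst rf_const \<psi> \<phi>"
  by (simp add: rf_comp_def rf_subst_def poly_at_rf_def)

lemma field_embedding_rf_const: "field_embedding rf_const"
  by unfold_locales (simp_all add: rf_const_def One_fract_def one_pCons mult.commute)

lemma rf_const_0 [simp]: "rf_const 0 = 0"
  by (simp add: rf_const_def fract_collapse)

lemma field_embedding_to_ac: "field_embedding to_ac"
  by unfold_locales simp_all

lemma field_embedding_fls_const: "field_embedding fls_const"
  by unfold_locales (simp_all add: fls_plus_const)

lemma field_embedding_comp:
  assumes "field_embedding f" "field_embedding g"
  shows "field_embedding (f \<circ> g)"
proof -
  interpret f: field_embedding f by fact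
  interpret g: field_embedding g by fact
  show ?thesis
    by unfold_locales (simp_all add: f.emb_add g.emb_add f.emb_mult g.emb_mult f.emb_one g.emb_one)
qed

lemma poly_rf_const_rf_X: "poly (map_poly rf_const p) rf_X = Fract p 1"
proof (induction p)
  case (pCons a p)
  thus ?case by (simp add: map_poly_pCons, simp add: rf_const_def rf_X_def)
qed (simp add: fract_collapse)

lemma map_poly_emb_eq_0_iff:
  assumes "field_embedding \<iota>"
  shows "map_poly \<iota> p = 0 \<longleftrightarrow> p = 0"
proof -
  interpret field_embedding \<iota> by fact
  show ?thesis by (auto simp: poly_eq_iff coeff_map_poly)
qed

lemma rf_substitution_rf_X:
  assumes "field_embedding \<iota>"
  shows "rf_substitution (rf_const \<circ> \<iota>) rf_X"
proof -
  interpret \<iota>: field_embedding \<iota> by fact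
  interpret field_embedding "rf_const \<circ> \<iota>"
    by (intro field_embedding_comp field_embedding_rf_const assms)
  show ?thesis
    by unfold_locales (auto simp: map_poly_o poly_rf_const_rf_X eq_fract Zero_fract_def map_poly_emb_eq_0_iff[OF assms])
qed

text \<open>A nonzero polynomial over an algebraically closed field splits into linear factors, and
  \<open>t - \<iota> z\<close> is nonzero for every \<open>z\<close>. So nonconstant already means
  transcendental.\<close>

lemma rf_substitution_alg_closed:
  fixes \<iota> :: "'a::alg_closed_field \<Rightarrow> 'b::field"
  assumes "field_embedding \<iota>" "t \<notin> range \<iota>"
  shows "rf_substitution \<iota> t"
proof -
  interpret field_embedding \<iota> by fact
  show ?thesis
  proof
    fix p :: "'a poly" assume "p \<noteq> 0"
    thus "poly (map_poly \<iota> p) t \<noteq> 0"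
    proof (induction "degree p" arbitrary: p)
      case 0
      then obtain c where "p = [:c:]" by (metis degree_eq_zeroE)
      thus ?case using 0 by (simp add: map_poly_pCons)
    next
      case (Suc n)
      obtain z where "poly p z = 0" using alg_closed_imp_poly_has_root[of p] Suc by auto
      then obtain q where q: "p = [:-z, 1:] * q" by (auto simp: poly_eq_0_iff_dvd elim!: dvdE)
      have "q \<noteq> 0" using q Suc by auto
      moreover have "degree q = n"
        using Suc(2) \<open>q \<noteq> 0\<close> unfolding q by (subst (asm) degree_mult_eq) auto
      ultimately have "poly (map_poly \<iota> q) t \<noteq> 0" using Suc by blast
      moreover have "t \<noteq> \<iota> z" using assms(2) by auto
      ultimately show ?case
        unfolding q poly_map_emb_mult by (simp add: map_poly_pCons emb_uminus emb_one)
    qed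
  qed
qed

lemma to_ac_rf_eq_rf_subst: "to_ac_rf \<phi> = rf_subst (rf_const \<circ> to_ac) rf_X \<phi>"
proof -
  have "map_poly to_ac (rf_den \<phi>) \<noteq> 0"
    by (simp add: map_poly_emb_eq_0_iff[OF field_embedding_to_ac])
  thus ?thesis
    by (simp add: to_ac_rf_def rf_subst_def map_poly_o poly_rf_const_rf_X divide_fract)
qed

lemma rf_nonconstant_to_ac_rf:
  assumes "rf_nonconstant \<phi>"
  shows "rf_nonconstant (to_ac_rf \<phi>)"
  unfolding rf_nonconstant_def
proof
  assume "to_ac_rf \<phi> \<in> range rf_const"
  then obtain c where c: "to_ac_rf \<phi> = Fract [:c:] 1" by (auto simp: rf_const_def)
  have "map_poly to_ac (rf_den \<phi>) \<noteq> 0"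
    by (simp add: map_poly_emb_eq_0_iff[OF field_embedding_to_ac])
  hence "map_poly to_ac (rf_num \<phi>) = smult c (map_poly to_ac (rf_den \<phi>))"
    using c by (simp add: to_ac_rf_def eq_fract)
  hence *: "to_ac (coeff (rf_num \<phi>) i) = c * to_ac (coeff (rf_den \<phi>) i)" for i
    by (metis coeff_map_poly coeff_smult to_ac_0)
  \<comment> \<open>In the degree of the monic denominator the identity reads off \<open>c\<close>,
    which therefore comes from the base field.\<close>
  define c' where "c' = coeff (rf_num \<phi>) (degree (rf_den \<phi>))"
  have c': "c = to_ac c'"
    using *[of "degree (rf_den \<phi>)"] rf_den_monic[of \<phi>] by (simp add: c'_def)
  have "rf_num \<phi> = smult c' (rf_den \<phi>)"
    using * unfolding c' by (simp add: poly_eq_iff flip: to_ac_mult)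
  hence "Fract (rf_num \<phi>) (rf_den \<phi>) = rf_const c'"
    by (simp add: rf_const_def eq_fract)
  hence "\<phi> = rf_const c'" by (simp only: rf_Fract_num_den)
  thus False using assms by (auto simp: rf_nonconstant_def)
qed

text \<open>Over an arbitrary field, transcendence is checked after extending scalars to the
  algebraic closure, where being nonconstant is enough.\<close>

lemma rf_substitution_nonconstant:
  fixes \<psi> :: "'a::field ratfun"
  assumes "rf_nonconstant \<psi>"
  shows "rf_substitution rf_const \<psi>"
proof -
  interpret field_embedding "rf_const :: 'a \<Rightarrow> 'a ratfun"
    by (rule field_embedding_rf_const)
  interpret ac: rf_substitution "rf_const \<circ> to_ac" "rf_X :: 'a alg_closure ratfun"
    by (rule rf_substitution_rf_X[OF field_embedding_to_ac])
  interpret L: rf_substitution rf_const "to_ac_rf \<psi>"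
    using rf_nonconstant_to_ac_rf[OF assms]
    by (intro rf_substitution_alg_closed field_embedding_rf_const) (simp add: rf_nonconstant_def)
  show ?thesis
  proof
    fix p :: "'a poly" assume "p \<noteq> 0"
    hence "map_poly to_ac p \<noteq> 0"
      by (simp add: map_poly_emb_eq_0_iff[OF field_embedding_to_ac])
    hence "poly (map_poly (rf_const \<circ> to_ac) p) (to_ac_rf \<psi>) \<noteq> 0"
      using L.transcendental by (simp add: map_poly_o)
    hence "rf_subst (rf_const \<circ> to_ac) rf_X (poly (map_poly rf_const p) \<psi>) \<noteq> 0"
      unfolding ac.rf_subst_poly to_ac_rf_eq_rf_subst .
    thus "poly (map_poly rf_const p) \<psi> \<noteq> 0" using ac.rf_subst_0 by metis
  qed
qed

section \<open>Algebra of composition\<close>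

lemma rf_comp_rf_X_left: "rf_nonconstant \<psi> \<Longrightarrow> rf_comp rf_X \<psi> = \<psi>"
  using rf_substitution.rf_subst_X[OF rf_substitution_nonconstant]
  by (simp add: rf_comp_eq_rf_subst)

lemma rf_comp_rf_X_right: "rf_comp \<phi> rf_X = \<phi>"
  by (simp add: rf_comp_def poly_at_rf_def poly_rf_const_rf_X divide_fract rf_Fract_num_den)

lemma rf_comp_right_cancel:
  "rf_nonconstant \<chi> \<Longrightarrow> rf_comp \<phi> \<chi> = rf_comp \<psi> \<chi> \<longleftrightarrow> \<phi> = \<psi>"
  using rf_substitution.inj_rf_subst[OF rf_substitution_nonconstant, of \<chi>]
  by (auto simp: rf_comp_eq_rf_subst dest: injD)

lemma rf_comp_assoc:
  assumes "rf_nonconstant \<chi>"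
  shows "rf_comp (rf_comp \<phi> \<psi>) \<chi> = rf_comp \<phi> (rf_comp \<psi> \<chi>)"
  using rf_substitution.rf_subst_rf_comp[OF rf_substitution_nonconstant[OF assms]]
  by (simp add: rf_comp_eq_rf_subst)

lemma rf_comp_inverse:
  "rf_nonconstant \<psi> \<Longrightarrow> rf_comp (inverse \<phi>) \<psi> = inverse (rf_comp \<phi> \<psi>)"
  using rf_substitution.rf_subst_inverse[OF rf_substitution_nonconstant]
  by (simp add: rf_comp_eq_rf_subst)

lemma rf_nonconstant_rf_comp:
  assumes "rf_nonconstant \<phi>" "rf_nonconstant \<psi>"
  shows "rf_nonconstant (rf_comp \<phi> \<psi>)"
  unfolding rf_nonconstant_def
proof
  assume "rf_comp \<phi> \<psi> \<in> range rf_const"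
  then obtain c where "rf_comp \<phi> \<psi> = rf_const c" by auto
  also have "rf_const c = rf_comp (rf_const c) \<psi>"
    using rf_substitution.rf_subst_const[OF rf_substitution_nonconstant[OF assms(2)]]
    by (simp add: rf_comp_eq_rf_subst)
  finally have "\<phi> = rf_const c" using assms(2) by (simp add: rf_comp_right_cancel)
  thus False using assms(1) by (auto simp: rf_nonconstant_def)
qed

lemma rf_nonconstant_inverse [simp]: "rf_nonconstant (inverse \<phi>) \<longleftrightarrow> rf_nonconstant \<phi>"
proof -
  have inv: "inverse (rf_const c) = rf_const (inverse c)" for c :: 'a
  proof (cases "c = 0")
    case False
    hence "rf_const c * rf_const (inverse c) = (1 :: 'a ratfun)"
      using field_embedding.emb_mult[OF field_embedding_rf_const, of c "inverse c"]
        field_embedding.emb_one[OF field_embedding_rf_const] by (metis right_inverse)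
    thus ?thesis by (rule inverse_unique)
  qed simp
  show ?thesis unfolding rf_nonconstant_def image_iff
    by (metis UNIV_I inv inverse_inverse_eq)
qed

lemma rf_nonconstant_rf_X [simp]: "rf_nonconstant rf_X"
  by (auto simp: rf_nonconstant_def rf_X_def rf_const_def eq_fract)

text \<open>Both sides equal \<open>\<phi>\<close> substituted at
  \<open>to_ac_rf \<psi>\<close>.\<close>

lemma to_ac_rf_rf_comp:
  assumes "rf_nonconstant \<psi>"
  shows "to_ac_rf (rf_comp \<phi> \<psi>) = rf_comp (to_ac_rf \<phi>) (to_ac_rf \<psi>)"
proof -
  interpret ac: rf_substitution "rf_const \<circ> to_ac" "rf_X :: 'a alg_closure ratfun"
    by (rule rf_substitution_rf_X[OF field_embedding_to_ac])
  interpret L: rf_substitution rf_const "to_ac_rf \<psi>"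
    by (rule rf_substitution_nonconstant[OF rf_nonconstant_to_ac_rf[OF assms]])
  have "to_ac_rf (rf_comp \<phi> \<psi>) = rf_subst (rf_const \<circ> to_ac) (to_ac_rf \<psi>) \<phi>"
    by (simp only: to_ac_rf_eq_rf_subst ac.rf_subst_rf_comp)
  also have "\<dots> = rf_subst rf_const (to_ac_rf \<psi>) (to_ac_rf \<phi>)"
    unfolding to_ac_rf_def[of \<phi>]
    by (subst L.rf_subst_Fract) (simp_all add: rf_subst_def map_poly_o map_poly_emb_eq_0_iff[OF field_embedding_to_ac])
  finally show ?thesis by (simp add: rf_comp_eq_rf_subst)
qed

lemma to_ac_rf_rf_X: "to_ac_rf rf_X = rf_X"
  using rf_substitution.rf_subst_X[OF rf_substitution_rf_X[OF field_embedding_to_ac]]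
  by (simp add: to_ac_rf_eq_rf_subst)

section \<open>Words in two rational functions\<close>

lemma rf_nonconstant_comp_word:
  "rf_nonconstant f \<Longrightarrow> rf_nonconstant g \<Longrightarrow> rf_nonconstant (comp_word f g w)"
  by (induction w) (auto intro: rf_nonconstant_rf_comp)

lemma comp_word_append:
  assumes "rf_nonconstant f" "rf_nonconstant g"
  shows "comp_word f g (u @ v) = rf_comp (comp_word f g u) (comp_word f g v)"
  using assms
  by (induction u) (simp_all add: rf_comp_rf_X_left rf_nonconstant_comp_word rf_comp_assoc)

lemma to_ac_rf_comp_word:
  assumes "rf_nonconstant f" "rf_nonconstant g"
  shows "to_ac_rf (comp_word f g w) = comp_word (to_ac_rf f) (to_ac_rf g) w"
  using assms
  by (induction w) (simp_all add: to_ac_rf_rf_X to_ac_rf_rf_comp rf_nonconstant_comp_word)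

lemma comp_word_image:
  assumes "rf_nonconstant f" "rf_nonconstant g"
  shows "comp_word f g ` {w. w \<noteq> []} = comp_semigroup f g"
proof
  have "comp_word f g w \<in> comp_semigroup f g" if "w \<noteq> []" for w
    using that
  proof (induction w rule: list_nonempty_induct)
    case (single x)
    show ?case by (simp add: rf_comp_rf_X_right comp_semigroup.intros)
  next
    case (cons x w)
    thus ?case by (simp add: comp_semigroup.intros)
  qed
  thus "comp_word f g ` {w. w \<noteq> []} \<subseteq> comp_semigroup f g" by blast
next
  have "\<exists>w. w \<noteq> [] \<and> \<phi> = comp_word f g w"
    if "\<phi> \<in> comp_semigroup f g" for \<phi>
    using that
  proof induction
    case 1
    show ?case by (rule exI[of _ "[True]"]) (simp add: rf_comp_rf_X_right)
  next
    case 2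
    show ?case by (rule exI[of _ "[False]"]) (simp add: rf_comp_rf_X_right)
  next
    case (3 \<phi> \<psi>)
    then obtain u v where "u \<noteq> []" "\<phi> = comp_word f g u" "\<psi> = comp_word f g v"
      by blast
    thus ?case using comp_word_append[OF assms] by (intro exI[of _ "u @ v"]) simp
  qed
  thus "comp_semigroup f g \<subseteq> comp_word f g ` {w. w \<noteq> []}" by blast
qed

text \<open>Transport of a rational function fixing infinity to one fixing 0.\<close>

definition rf_flip :: "'a::field ratfun \<Rightarrow> 'a ratfun" where
  "rf_flip \<phi> = inverse (rf_comp \<phi> (inverse rf_X))"

lemma rf_nonconstant_rf_flip: "rf_nonconstant \<phi> \<Longrightarrow> rf_nonconstant (rf_flip \<phi>)"
  by (simp add: rf_flip_def rf_nonconstant_rf_comp)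

lemma inj_rf_flip: "rf_flip \<phi> = rf_flip \<psi> \<Longrightarrow> \<phi> = \<psi>"
  by (simp add: rf_flip_def rf_comp_right_cancel)

lemma rf_flip_rf_X: "rf_flip rf_X = rf_X"
  by (simp add: rf_flip_def rf_comp_rf_X_left)

text \<open>\<open>rf_flip\<close> is conjugation by the involution \<open>1/x\<close>, so the two
  inner inversions cancel.\<close>

lemma rf_flip_rf_comp:
  assumes "rf_nonconstant \<psi>"
  shows "rf_flip (rf_comp \<phi> \<psi>) = rf_comp (rf_flip \<phi>) (rf_flip \<psi>)"
proof -
  have \<psi>: "rf_nonconstant (rf_flip \<psi>)" using assms by (rule rf_nonconstant_rf_flip)
  have "rf_comp (rf_flip \<phi>) (rf_flip \<psi>) = inverse (rf_comp \<phi> (rf_comp (inverse rf_X) (rf_flip \<psi>)))"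
    using \<psi> by (simp add: rf_flip_def[of \<phi>] rf_comp_inverse rf_comp_assoc)
  also have "rf_comp (inverse rf_X) (rf_flip \<psi>) = inverse (rf_flip \<psi>)"
    using \<psi> by (simp add: rf_comp_inverse rf_comp_rf_X_left)
  also have "\<dots> = rf_comp \<psi> (inverse rf_X)" by (simp add: rf_flip_def)
  finally show ?thesis by (simp add: rf_flip_def rf_comp_assoc)
qed

lemma rf_flip_comp_word:
  assumes "rf_nonconstant f" "rf_nonconstant g"
  shows "rf_flip (comp_word f g w) = comp_word (rf_flip f) (rf_flip g) w"
  using assms
  by (induction w) (simp_all add: rf_flip_rf_X rf_flip_rf_comp rf_nonconstant_comp_word)

section \<open>Values and local expansions\<close>

text \<open>The place of the Laurent series field. Values of rational functions are computed by substituting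
  a series and taking its residue, which makes evaluation compatible with composition at all points
  of the projective line at once.\<close>

definition fls_residue_value :: "'a::field fls \<Rightarrow> 'a P1" where
  "fls_residue_value t = (if fls_subdegree t < 0 then Infinity else Affine (t $$ 0))"

definition poly_fps :: "'a::field poly \<Rightarrow> 'a fps \<Rightarrow> 'a fps" where
  "poly_fps p s = poly (map_poly fps_const p) s"

lemma poly_fps_0 [simp]: "poly_fps 0 s = 0"
  by (simp add: poly_fps_def)

lemma poly_fps_pCons [simp]: "poly_fps (pCons c p) s = fps_const c + s * poly_fps p s"
  by (simp add: poly_fps_def map_poly_pCons)

lemma poly_fps_nth_0: "poly_fps p s $ 0 = poly p (s $ 0)"
  by (induction p) simp_all

lemma poly_fls_const_fps_to_fls:
  "poly (map_poly fls_const p) (fps_to_fls s) = fps_to_fls (poly_fps p s)"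
  by (induction p) (simp_all add: map_poly_pCons fls_times_fps_to_fls)

lemma poly_fps_compose:
  fixes T :: "'a::field fps"
  assumes "T $ 0 = 0"
  shows "poly_fps p s oo T = poly_fps p (s oo T)"
  by (induction p) (simp_all add: assms fps_compose_add_distrib fps_compose_mult_distrib)

lemma fps_of_poly_pcompose_eq:
  "fps_of_poly (p \<circ>\<^sub>p [:a, 1:]) = poly_fps p (fps_const a + fps_X)"
  by (induction p)
     (simp_all add: pcompose_pCons fps_of_poly_add fps_of_poly_smult fps_of_poly_pCons algebra_simps)

lemma fps_to_fls_divide:
  fixes P Q :: "'a::field fps"
  assumes "Q $ 0 \<noteq> 0"
  shows "fps_to_fls P / fps_to_fls Q = fps_to_fls (P / Q)"
proof -
  have "P = (P / Q) * Q" using assms by (simp add: fps_divide_unit mult.assoc inverse_mult_eq_1)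
  hence "fps_to_fls P = fps_to_fls (P / Q) * fps_to_fls Q" by (metis fls_times_fps_to_fls)
  moreover have "Q \<noteq> 0" using assms by auto
  ultimately show ?thesis by (simp add: divide_eq_eq)
qed

lemma fls_residue_value_divide:
  fixes P Q :: "'a::field fps"
  assumes "P $ 0 \<noteq> 0 \<or> Q $ 0 \<noteq> 0" "Q \<noteq> 0"
  shows "fls_residue_value (fps_to_fls P / fps_to_fls Q) =
           (if Q $ 0 = 0 then Infinity else Affine (P $ 0 / Q $ 0))"
proof (cases "Q $ 0 = 0")
  case True
  hence "P $ 0 \<noteq> 0" using assms by simp
  hence P: "P \<noteq> 0" "subdegree P = 0" by auto
  have "subdegree Q > 0" using True assms(2) by (metis gr0I nth_subdegree_nonzero)
  hence "fls_subdegree (fps_to_fls P / fps_to_fls Q) < 0"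
    using P assms(2) by (simp add: fls_divide_subdegree fls_subdegree_fls_to_fps)
  thus ?thesis using True by (simp add: fls_residue_value_def)
next
  case False
  hence "(P / Q) $ 0 = P $ 0 / Q $ 0" by (simp add: fps_divide_unit divide_inverse)
  thus ?thesis
    using False unfolding fps_to_fls_divide[OF False]
    by (simp add: fls_residue_value_def fls_subdegree_fls_to_fps)
qed

lemma coprime_poly_roots:
  fixes p q :: "'a::field poly"
  assumes "coprime p q" "poly q z = 0"
  shows "poly p z \<noteq> 0"
proof
  assume "poly p z = 0"
  hence "[:-z, 1:] dvd p" "[:-z, 1:] dvd q" using assms(2) by (simp_all add: poly_eq_0_iff_dvd)
  with assms(1) have "is_unit [:-z, 1:]" by (rule coprime_common_divisor)
  thus False by (simp add: is_unit_iff_degree)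
qed

lemma fls_residue_value_Affine:
  assumes "fls_residue_value t = Affine z"
  obtains s where "t = fps_to_fls s" "s $ 0 = z"
proof
  have "fls_subdegree t \<ge> 0" "t $$ 0 = z"
    using assms by (auto simp: fls_residue_value_def split: if_splits)
  thus "t = fps_to_fls (fls_regpart t)" "fls_regpart t $ 0 = z" by auto
qed

lemma fls_residue_value_Infinity:
  assumes "fls_residue_value t = Infinity"
  obtains s where "t = inverse (fps_to_fls s)" "s $ 0 = 0" "s \<noteq> 0"
proof -
  have t: "fls_subdegree t < 0"
    using assms by (auto simp: fls_residue_value_def split: if_splits)
  hence t0: "t \<noteq> 0" by auto
  have sd: "fls_subdegree (inverse t) > 0" using t t0 by simp
  define s where "s = fls_regpart (inverse t)"
  have s: "inverse t = fps_to_fls s" using sd by (simp add: s_def)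
  hence "t = inverse (fps_to_fls s)" by (metis inverse_inverse_eq)
  moreover have "s \<noteq> 0" using s t0 by auto
  moreover have "s $ 0 = 0" using sd by (simp add: s_def)
  ultimately show ?thesis using that by blast
qed

lemma reflect_poly_map_emb:
  assumes "field_embedding \<iota>"
  shows "reflect_poly (map_poly \<iota> p) = map_poly \<iota> (reflect_poly p)"
proof -
  interpret field_embedding \<iota> by fact
  have "degree (map_poly \<iota> p) = degree p" by (intro degree_map_poly) auto
  thus ?thesis by (auto simp: poly_eq_iff coeff_map_poly coeff_reflect_poly)
qed

text \<open>At affine values coprimality of numerator and denominator rules out 0/0; at infinity the
  series is written as \<open>1/s\<close> and the polynomials are reversed.\<close>

lemma fls_residue_value_rf_subst:
  fixes t :: "'a::field fls"
  assumes "rf_substitution fls_const t"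
  shows "fls_residue_value (rf_subst fls_const t \<phi>) = rf_eval \<phi> (fls_residue_value t)"
proof -
  interpret rf_substitution fls_const t by fact
  let ?p = "rf_num \<phi>" and ?q = "rf_den \<phi>"
  show ?thesis
  proof (cases "fls_residue_value t")
    case (Affine z)
    then obtain s where s: "t = fps_to_fls s" "s $ 0 = z" by (rule fls_residue_value_Affine)
    have "poly_fps ?q s \<noteq> 0"
      using transcendental[of ?q] by (auto simp: s(1) poly_fls_const_fps_to_fls)
    moreover have "poly_fps ?p s $ 0 \<noteq> 0 \<or> poly_fps ?q s $ 0 \<noteq> 0"
      using coprime_poly_roots[OF rf_coprime] by (auto simp: poly_fps_nth_0)
    ultimately show ?thesis
      unfolding Affine rf_subst_def
      by (simp add: s poly_fls_const_fps_to_fls fls_residue_value_divide poly_fps_nth_0)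
  next
    case Infinity
    then obtain s where s: "t = inverse (fps_to_fls s)" "s $ 0 = 0" "s \<noteq> 0"
      by (rule fls_residue_value_Infinity)
    \<comment> \<open>\<open>P p\<close> is \<open>s ^ degree p * p(1/s)\<close>, a power series
      whose constant term is the leading coefficient of \<open>p\<close>.\<close>
    define P where "P p = poly_fps (reflect_poly p) s" for p
    have P0: "P p $ 0 = lead_coeff p" for p
      by (simp add: P_def poly_fps_nth_0 s poly_0_coeff_0)
    have P: "poly (map_poly fls_const p) t = fps_to_fls (P p) / fps_to_fls s ^ degree p" for p
    proof -
      have deg: "degree (map_poly fls_const p) = degree p" by (intro degree_map_poly) auto
      have "fps_to_fls (P p) = poly (reflect_poly (map_poly fls_const p)) (fps_to_fls s)"
        by (simp add: P_def poly_fls_const_fps_to_fls reflect_poly_map_emb[OF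
            field_embedding_fls_const])
      also have "\<dots> = fps_to_fls s ^ degree p * poly (map_poly fls_const p) t"
        using s(3) by (subst poly_reflect_poly_nz) (simp_all add: deg s(1))
      finally show ?thesis using s(3) by simp
    qed
    have sub: "rf_subst fls_const t \<phi> =
        (fps_to_fls (P ?p) / fps_to_fls s ^ degree ?p) / (fps_to_fls (P ?q) / fps_to_fls s ^ degree ?q)"
      by (simp add: rf_subst_def P)
    have q0: "P ?q $ 0 = 1" by (simp add: P0 rf_den_monic)
    hence qnz: "P ?q \<noteq> 0" by auto
    show ?thesis
    proof (cases "degree ?p > degree ?q")
      case True
      define j where "j = degree ?p - degree ?q"
      have j: "degree ?p = degree ?q + j" "j > 0" using True by (auto simp: j_def)
      have "rf_subst fls_const t \<phi> = fps_to_fls (P ?p) / fps_to_fls (s ^ j * P ?q)"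
        unfolding sub using s(3) qnz
          by (simp add: j power_add fls_times_fps_to_fls fps_to_fls_power)
      moreover have "P ?p $ 0 \<noteq> 0" using True by (auto simp: P0)
      moreover have "s ^ j * P ?q \<noteq> 0" using s(3) qnz by simp
      moreover have "(s ^ j * P ?q) $ 0 = 0" using s(2) j(2) by simp
      ultimately show ?thesis using True by (simp add: Infinity fls_residue_value_divide)
    next
      case False
      define j where "j = degree ?q - degree ?p"
      have j: "degree ?q = degree ?p + j" using False by (auto simp: j_def)
      have "rf_subst fls_const t \<phi> = fps_to_fls (s ^ j * P ?p) / fps_to_fls (P ?q)"
        unfolding sub using s(3) qnz
          by (simp add: j power_add fls_times_fps_to_fls fps_to_fls_power)
      \<comment> \<open>If \<open>j > 0\<close>, both sides are zero, as \<open>degree ?q\<close>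
        exceeds \<open>degree ?p\<close>.\<close>
      moreover have "(s ^ j * P ?p) $ 0 = coeff ?p (degree ?q)"
        using s(2) j by (cases "j = 0") (auto simp: P0 coeff_eq_0)
      ultimately show ?thesis using False q0 qnz
        by (simp add: Infinity fls_residue_value_divide rf_den_monic)
    qed
  qed
qed

section \<open>Evaluation of compositions on the projective line\<close>

lemma rf_substitution_fls:
  fixes t :: "'a::alg_closed_field fls"
  assumes "t \<notin> range fls_const"
  shows "rf_substitution fls_const t"
  by (intro rf_substitution_alg_closed field_embedding_fls_const assms)

text \<open>The coordinate function near the point, expanded in a local parameter: a nonconstant
  Laurent series with the given value.\<close>

fun P1_uniformizer :: "'a::field P1 \<Rightarrow> 'a fls" where
  "P1_uniformizer (Affine a) = fls_const a + fls_X"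
| "P1_uniformizer Infinity = fls_X_inv"

lemma P1_uniformizer_not_const: "P1_uniformizer x \<notin> range fls_const"
proof (cases x)
  case (Affine a)
  have "(fls_const a + fls_X) $$ 1 \<noteq> fls_const c $$ 1" for c by simp
  thus ?thesis unfolding Affine by (metis P1_uniformizer.simps(1) imageE)
next
  case Infinity
  have "(fls_X_inv :: 'a fls) $$ (-1) \<noteq> fls_const c $$ (-1)" for c by simp
  thus ?thesis unfolding Infinity by (metis P1_uniformizer.simps(2) imageE)
qed

lemma fls_residue_value_P1_uniformizer: "fls_residue_value (P1_uniformizer x) = x"
proof (cases x)
  case (Affine a)
  have "fls_const a + fls_X = fps_to_fls (fps_const a + fps_X)" by simp
  thus ?thesis unfolding Affine fls_residue_value_def
    by (simp add: fls_subdegree_fls_to_fps del: fps_to_fls_plus)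
qed (simp add: fls_residue_value_def)

lemma rf_subst_not_const:
  assumes "rf_substitution \<iota> t" "rf_nonconstant \<psi>"
  shows "rf_subst \<iota> t \<psi> \<notin> range \<iota>"
proof
  interpret rf_substitution \<iota> t by fact
  assume "rf_subst \<iota> t \<psi> \<in> range \<iota>"
  then obtain c where "rf_subst \<iota> t \<psi> = rf_subst \<iota> t (rf_const c)" by auto
  hence "\<psi> = rf_const c" by (rule injD[OF inj_rf_subst])
  thus False using assms(2) by (auto simp: rf_nonconstant_def)
qed

lemma rf_eval_rf_comp:
  fixes \<phi> \<psi> :: "'a::alg_closed_field ratfun"
  assumes "rf_nonconstant \<psi>"
  shows "rf_eval (rf_comp \<phi> \<psi>) x = rf_eval \<phi> (rf_eval \<psi> x)"
proof -
  let ?t = "P1_uniformizer x"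
  have t: "rf_substitution fls_const ?t" by (rule rf_substitution_fls[OF P1_uniformizer_not_const])
  \<comment> \<open>As \<open>\<psi>\<close> is nonconstant, \<open>?u\<close> is again
    transcendental and may be substituted into \<open>\<phi>\<close>.\<close>
  let ?u = "rf_subst fls_const ?t \<psi>"
  have u: "rf_substitution fls_const ?u"
    by (rule rf_substitution_fls[OF rf_subst_not_const[OF t assms]])
  have "rf_eval (rf_comp \<phi> \<psi>) x = fls_residue_value (rf_subst fls_const ?t (rf_comp \<phi> \<psi>))"
    by (simp add: fls_residue_value_rf_subst[OF t] fls_residue_value_P1_uniformizer)
  also have "\<dots> = fls_residue_value (rf_subst fls_const ?u \<phi>)"
    by (simp add: rf_substitution.rf_subst_rf_comp[OF t])
  also have "\<dots> = rf_eval \<phi> (rf_eval \<psi> x)"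
    by (simp add: fls_residue_value_rf_subst[OF u] fls_residue_value_rf_subst[OF t]
        fls_residue_value_P1_uniformizer)
  finally show ?thesis .
qed

lemma rf_eval_rf_X:
  fixes x :: "'a::alg_closed_field P1"
  shows "rf_eval rf_X x = x"
proof -
  have t: "rf_substitution fls_const (P1_uniformizer x)"
    by (rule rf_substitution_fls[OF P1_uniformizer_not_const])
  show ?thesis
    using fls_residue_value_rf_subst[OF t, of rf_X]
    by (simp add: rf_substitution.rf_subst_X[OF t] fls_residue_value_P1_uniformizer)
qed

lemma rf_eval_comp_word:
  fixes F G :: "'a::alg_closed_field ratfun"
  assumes "rf_nonconstant F" "rf_nonconstant G"
  shows "rf_eval (comp_word F G w) x = foldr (\<lambda>b. rf_eval (if b then F else G)) w x"
  using assms
  by (induction w) (simp_all add: rf_eval_rf_X rf_eval_rf_comp rf_nonconstant_comp_word)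

lemma foldr_replicate_funpow: "foldr f (replicate n b) x = (f b ^^ n) x"
  by (induction n) auto

lemma rf_eval_rf_flip_0:
  fixes \<phi> :: "'a::alg_closed_field ratfun"
  assumes "rf_eval \<phi> Infinity = Infinity"
  shows "rf_eval (rf_flip \<phi>) (Affine 0) = Affine 0"
proof -
  let ?t = "P1_uniformizer (Affine 0) :: 'a fls" and ?u = "P1_uniformizer Infinity :: 'a fls"
  have t: "rf_substitution fls_const ?t" and u: "rf_substitution fls_const ?u"
    by (rule rf_substitution_fls[OF P1_uniformizer_not_const])+
  have tu: "inverse ?t = ?u" by (simp add: fls_inverse_X)
  have "rf_subst fls_const ?t (rf_flip \<phi>) = inverse (rf_subst fls_const ?u \<phi>)"
    by (simp only: rf_flip_def rf_substitution.rf_subst_inverse[OF t]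
        rf_substitution.rf_subst_rf_comp[OF t]
        rf_substitution.rf_subst_X[OF t] tu)
  moreover have "fls_residue_value (rf_subst fls_const ?u \<phi>) = Infinity"
    using assms by (simp only: fls_residue_value_rf_subst[OF u] fls_residue_value_P1_uniformizer)
  then obtain s where "rf_subst fls_const ?u \<phi> = inverse (fps_to_fls s)" "s $ 0 = 0"
    by (rule fls_residue_value_Infinity)
  ultimately have "fls_residue_value (rf_subst fls_const ?t (rf_flip \<phi>)) = Affine 0"
    by (simp add: fls_residue_value_def fls_subdegree_fls_to_fps)
  thus ?thesis by (simp only: fls_residue_value_rf_subst[OF t] fls_residue_value_P1_uniformizer)
qed

section \<open>Local expansions at a common fixed point\<close>

definition local_expansion :: "'a::field ratfun \<Rightarrow> 'a \<Rightarrow> 'a fps" where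
  "local_expansion \<phi> a = rf_expansion \<phi> a - fps_const a"

lemma rf_expansion_mult_den:
  assumes "poly (rf_den \<phi>) a \<noteq> 0"
  shows "rf_expansion \<phi> a * poly_fps (rf_den \<phi>) (fps_const a + fps_X) =
           poly_fps (rf_num \<phi>) (fps_const a + fps_X)"
  using assms
  by (simp add: rf_expansion_def fps_of_poly_pcompose_eq fps_divide_unit poly_fps_nth_0 mult.assoc
      inverse_mult_eq_1)

lemma rf_subst_eq_rf_expansion:
  assumes "poly (rf_den \<phi>) a \<noteq> 0"
  shows "rf_subst fls_const (P1_uniformizer (Affine a)) \<phi> = fps_to_fls (rf_expansion \<phi> a)"
proof -
  have X: "P1_uniformizer (Affine a) = fps_to_fls (fps_const a + fps_X)" by simp
  show ?thesis
    unfolding rf_subst_def X poly_fls_const_fps_to_fls rf_expansion_def fps_of_poly_pcompose_eq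
    by (rule fps_to_fls_divide) (simp add: poly_fps_nth_0 assms)
qed

lemma local_expansion_nth_0:
  assumes "rf_eval \<phi> (Affine a) = Affine a"
  shows "local_expansion \<phi> a $ 0 = 0"
proof -
  have "poly (rf_den \<phi>) a \<noteq> 0" "poly (rf_num \<phi>) a / poly (rf_den \<phi>) a = a"
    using assms by (auto split: if_splits)
  thus ?thesis
    by (simp add: local_expansion_def rf_expansion_def fps_of_poly_pcompose_eq fps_divide_unit
        poly_fps_nth_0 divide_inverse)
qed

text \<open>\<open>rf_expansion\<close> centres the source at \<open>a\<close>; subtracting
  \<open>a\<close> centres the target there too, so composition of maps becomes composition of
  series without constant term.\<close>

lemma local_expansion_rf_comp:
  fixes \<phi> \<psi> :: "'a::alg_closed_field ratfun"
  assumes \<phi>: "rf_eval \<phi> (Affine a) = Affine a" and \<psi>: "rf_eval \<psi> (Affine a) = Affine a"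
    and nc: "rf_nonconstant \<psi>"
  shows "local_expansion (rf_comp \<phi> \<psi>) a = local_expansion \<phi> a oo local_expansion \<psi> a"
proof -
  let ?t = "P1_uniformizer (Affine a)"
  have t: "rf_substitution fls_const ?t" by (rule rf_substitution_fls[OF P1_uniformizer_not_const])
  have den: "poly (rf_den \<chi>) a \<noteq> 0" if "rf_eval \<chi> (Affine a) = Affine a" for \<chi>
    using that by (auto split: if_splits)
  define T where "T = local_expansion \<psi> a"
  have T0: "T $ 0 = 0" unfolding T_def by (rule local_expansion_nth_0[OF \<psi>])
  have s: "rf_expansion \<psi> a = fps_const a + T" by (simp add: T_def local_expansion_def)
  let ?P = "\<lambda>p. poly_fps p (fps_const a + T)"
  have sub: "(fps_const a + fps_X) oo T = fps_const a + T"
    by (simp add: fps_compose_add_distrib fps_X_oo T0)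
  \<comment> \<open>Composing the cleared-denominator identity with \<open>T\<close> expresses the
    value of \<open>\<phi>\<close> at \<open>a + T\<close> as a power series.\<close>
  have "(rf_expansion \<phi> a oo T) * ?P (rf_den \<phi>) = ?P (rf_num \<phi>)"
    using arg_cong[OF rf_expansion_mult_den[OF den[OF \<phi>]], of "\<lambda>F. F oo T"]
    by (simp add: fps_compose_mult_distrib T0 poly_fps_compose sub)
  moreover have "?P (rf_den \<phi>) $ 0 \<noteq> 0"
    using den[OF \<phi>] by (simp add: poly_fps_nth_0 T0)
  ultimately have *: "fps_to_fls (?P (rf_num \<phi>)) / fps_to_fls (?P (rf_den \<phi>)) = fps_to_fls (rf_expansion \<phi> a oo T)"
    by (metis divisors_zero fls_times_fps_to_fls fps_to_fls_eq_0_iff fps_zero_nth nonzero_mult_div_cancel_right)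
  have "rf_eval (rf_comp \<phi> \<psi>) (Affine a) = Affine a"
    using \<phi> \<psi> nc by (simp add: rf_eval_rf_comp del: rf_eval.simps)
  hence "fps_to_fls (rf_expansion (rf_comp \<phi> \<psi>) a) = rf_subst fls_const ?t (rf_comp \<phi> \<psi>)"
    by (simp only: rf_subst_eq_rf_expansion[OF den])
  also have "\<dots> = rf_subst fls_const (fps_to_fls (fps_const a + T)) \<phi>"
    by (simp only: rf_substitution.rf_subst_rf_comp[OF t] rf_subst_eq_rf_expansion[OF den[OF
        \<psi>]] s)
  also have "\<dots> = fps_to_fls (rf_expansion \<phi> a oo T)"
    unfolding rf_subst_def poly_fls_const_fps_to_fls by (rule *)
  finally have "rf_expansion (rf_comp \<phi> \<psi>) a = rf_expansion \<phi> a oo T" by simp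
  thus ?thesis unfolding T_def[symmetric] by (simp add: local_expansion_def fps_compose_sub_distrib)
qed

lemma local_expansion_rf_X:
  fixes a :: "'a::alg_closed_field"
  shows "local_expansion rf_X a = fps_X"
proof -
  let ?t = "P1_uniformizer (Affine a)"
  have t: "rf_substitution fls_const ?t" by (rule rf_substitution_fls[OF P1_uniformizer_not_const])
  have "rf_eval rf_X (Affine a) = Affine a" by (rule rf_eval_rf_X)
  hence "poly (rf_den rf_X) a \<noteq> 0" by (auto split: if_splits)
  from rf_subst_eq_rf_expansion[OF this] have "fps_to_fls (rf_expansion rf_X a) = fps_to_fls (fps_const a + fps_X)"
    by (simp only: rf_substitution.rf_subst_X[OF t]) simp
  thus ?thesis unfolding local_expansion_def fps_to_fls_eq_iff by simp
qed

lemma local_expansion_inj: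
  fixes \<phi> \<psi> :: "'a::alg_closed_field ratfun"
  assumes \<phi>: "rf_eval \<phi> (Affine a) = Affine a" and \<psi>: "rf_eval \<psi> (Affine a) = Affine a"
    and "local_expansion \<phi> a = local_expansion \<psi> a"
  shows "\<phi> = \<psi>"
proof -
  have den: "poly (rf_den \<chi>) a \<noteq> 0" if "rf_eval \<chi> (Affine a) = Affine a" for \<chi>
    using that by (auto split: if_splits)
  have "rf_subst fls_const (P1_uniformizer (Affine a)) \<phi> = rf_subst fls_const (P1_uniformizer (Affine a)) \<psi>"
    using assms(3)
    by (simp add: rf_subst_eq_rf_expansion den \<phi> \<psi> local_expansion_def del:
        rf_eval.simps P1_uniformizer.simps)
  thus ?thesis
    using rf_substitution.inj_rf_subst[OF rf_substitution_fls[OF P1_uniformizer_not_const]]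
    by (blast dest: injD)
qed

lemma rf_e_eq_subdegree:
  fixes \<phi> :: "'a::alg_closed_field ratfun"
  assumes \<phi>: "rf_eval \<phi> (Affine a) = Affine a" and nc: "rf_nonconstant \<phi>"
  shows "rf_e \<phi> (Affine a) = subdegree (local_expansion \<phi> a)"
proof -
  let ?t = "P1_uniformizer (Affine a)"
  have t: "rf_substitution fls_const ?t" by (rule rf_substitution_fls[OF P1_uniformizer_not_const])
  have "poly (rf_den \<phi>) a \<noteq> 0" using \<phi> by (auto split: if_splits)
  hence "rf_expansion \<phi> a \<noteq> fps_const a"
    using rf_subst_eq_rf_expansion[of \<phi> a] rf_subst_not_const[OF t nc] by auto
  hence nz: "local_expansion \<phi> a \<noteq> 0" by (simp add: local_expansion_def)
  \<comment> \<open>At a fixed point the constant term of the expansion is \<open>a\<close>;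
    subtracting it leaves exactly the terms that \<open>lowest_pos_degree\<close> searches.\<close>
  have "0 < n \<and> rf_expansion \<phi> a $ n \<noteq> 0 \<longleftrightarrow> local_expansion \<phi> a $ n \<noteq> 0" for n
    using local_expansion_nth_0[OF \<phi>] by (cases "n = 0") (auto simp: local_expansion_def)
  thus ?thesis using nz by (simp add: lowest_pos_degree_def subdegree_def)
qed

lemma rf_eval_comp_word_fixed:
  fixes F G :: "'a::alg_closed_field ratfun"
  assumes "rf_nonconstant F" "rf_nonconstant G" "rf_eval F x = x" "rf_eval G x = x"
  shows "rf_eval (comp_word F G w) x = x"
  using assms
  by (induction w) (simp_all add: rf_eval_rf_X rf_eval_rf_comp rf_nonconstant_comp_word)

lemma local_expansion_comp_word:
  fixes F G :: "'a::alg_closed_field ratfun"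
  assumes "rf_nonconstant F" "rf_nonconstant G"
    and "rf_eval F (Affine a) = Affine a" "rf_eval G (Affine a) = Affine a"
  shows "local_expansion (comp_word F G w) a = fps_word (local_expansion F a) (local_expansion G a) w"
  using assms
  by (induction w)
     (simp_all add: local_expansion_rf_X local_expansion_rf_comp rf_nonconstant_comp_word
        rf_eval_comp_word_fixed del: rf_eval.simps)

section \<open>Relations between rational functions\<close>

lemma subdegree_fps_word_replicate:
  fixes A B :: "'a::idom fps"
  assumes "subdegree A > 0"
  shows "fps_word A B (replicate n True) \<noteq> 0 \<and> subdegree (fps_word A B (replicate n True)) = subdegree A ^ n"
proof (induction n)
  case (Suc n)
  have "fps_word A B (replicate n True) $ 0 = 0"
    using Suc assms by (intro nth_less_subdegree_zero) simp
  moreover have "A \<noteq> 0" using assms by auto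
  ultimately have "subdegree (fps_word A B (replicate (Suc n) True)) = subdegree A ^ Suc n"
    using Suc by (simp add: subdegree_fps_compose)
  moreover from this have "fps_word A B (replicate (Suc n) True) \<noteq> 0" using assms by auto
  ultimately show ?case by blast
qed simp

lemma comp_word_relation_Affine:
  fixes F G :: "'a::alg_closed_field ratfun"
  assumes nc: "rf_nonconstant F" "rf_nonconstant G"
    and fixed: "rf_eval F (Affine z) = Affine z" "rf_eval G (Affine z) = Affine z"
    and e: "rf_e F (Affine z) > 1" "rf_e G (Affine z) > 1"
      "of_nat (rf_e F (Affine z)) \<noteq> (0::'a)" "of_nat (rf_e G (Affine z)) \<noteq> (0::'a)"
    and rel: "comp_word F G u = comp_word F G v" "u \<noteq> v"
  obtains a r where "r > 0"
    "\<And>k. comp_word F G (replicate (a + r) True @ replicate k False) =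
          comp_word F G (replicate a True @ replicate k False @ replicate r True)"
    "inj (\<lambda>n. comp_word F G (replicate n True))"
proof -
  let ?A = "local_expansion F z" and ?B = "local_expansion G z"
  have e': "rf_e F (Affine z) = subdegree ?A" "rf_e G (Affine z) = subdegree ?B"
    using rf_e_eq_subdegree fixed nc by blast+
  note word = local_expansion_comp_word[OF nc fixed]
  have eq_iff: "comp_word F G p = comp_word F G q \<longleftrightarrow> fps_word ?A ?B p = fps_word ?A ?B q" for p q
    using local_expansion_inj[OF rf_eval_comp_word_fixed[OF nc fixed, of p] rf_eval_comp_word_fixed[OF nc fixed, of q]]
    by (metis word)
  obtain a r where ar: "r > 0"
    "\<And>k. fps_word ?A ?B (replicate (a + r) True @ replicate k False) =
          fps_word ?A ?B (replicate a True @ replicate k False @ replicate r True)"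
    using fps_word_relation[of ?A ?B u v] e rel unfolding e' eq_iff by (metis Suc_1 Suc_leI)
  \<comment> \<open>The \<open>n\<close>-th iterate has order the \<open>n\<close>-th power of a
    number above 1, so iterates are distinct. This later makes the set where two of them agree
    finite.\<close>
  have "inj (\<lambda>n. comp_word F G (replicate n True))"
  proof (rule injI)
    fix m n assume "comp_word F G (replicate m True) = comp_word F G (replicate n True)"
    hence "subdegree ?A ^ m = subdegree ?A ^ n"
      using subdegree_fps_word_replicate[of ?A ?B] e(1)
        by (metis e'(1) eq_iff gr_zeroI not_less_zero)
    thus "m = n" using e(1) e'(1) by (simp add: power_inject_exp)
  qed
  with ar show ?thesis using that unfolding eq_iff[symmetric] by blast
qed

lemma comp_word_relation:
  fixes F G :: "'a::alg_closed_field ratfun"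
  assumes nc: "rf_nonconstant F" "rf_nonconstant G"
    and fixed: "rf_eval F \<alpha> = \<alpha>" "rf_eval G \<alpha> = \<alpha>"
    and e: "rf_e F \<alpha> > 1" "rf_e G \<alpha> > 1"
      "of_nat (rf_e F \<alpha>) \<noteq> (0::'a)" "of_nat (rf_e G \<alpha>) \<noteq> (0::'a)"
    and rel: "comp_word F G u = comp_word F G v" "u \<noteq> v"
  obtains a r where "r > 0"
    "\<And>k. comp_word F G (replicate (a + r) True @ replicate k False) =
          comp_word F G (replicate a True @ replicate k False @ replicate r True)"
    "inj (\<lambda>n. comp_word F G (replicate n True))"
proof (cases \<alpha>)
  case (Affine z)
  thus ?thesis using comp_word_relation_Affine[of F G z u v] assms that by blast
next
  case Infinity
  let ?F = "rf_flip F" and ?G = "rf_flip G"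
  note flip = rf_flip_comp_word[OF nc, symmetric]
  have eq_iff: "comp_word ?F ?G p = comp_word ?F ?G q \<longleftrightarrow> comp_word F G p = comp_word F G q" for p q
    unfolding flip using inj_rf_flip by auto
  \<comment> \<open>At infinity \<open>rf_e\<close> is defined through the flipped function at 0, so
    the affine case applies there.\<close>
  have e_flip: "rf_e \<phi> Infinity = rf_e (rf_flip \<phi>) (Affine 0)" for \<phi> :: "'a ratfun"
    by (simp add: rf_flip_def)
  obtain a r where ar: "r > 0"
    "\<And>k. comp_word ?F ?G (replicate (a + r) True @ replicate k False) =
          comp_word ?F ?G (replicate a True @ replicate k False @ replicate r True)"
    "inj (\<lambda>n. comp_word ?F ?G (replicate n True))"
    using comp_word_relation_Affine[of ?F ?G 0 u v] rf_nonconstant_rf_flip[OF nc(1)] rf_nonconstant_rf_flip[OF nc(2)]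
      rf_eval_rf_flip_0 fixed e rel unfolding Infinity e_flip eq_iff by metis
  have "inj (\<lambda>n. comp_word F G (replicate n True))"
    using ar(3) unfolding inj_def eq_iff .
  thus ?thesis using that ar(1,2) unfolding eq_iff by blast
qed

section \<open>Preperiodic points\<close>

lemma finite_rf_eval_eq:
  assumes "\<phi> \<noteq> \<psi>"
  shows "finite {x. rf_eval \<phi> x = rf_eval \<psi> x}"
proof -
  \<comment> \<open>The cross-multiplied difference vanishes at affine points with equal values,
    common poles included. Infinity is added to the exceptional set outright.\<close>
  define D where "D = rf_num \<phi> * rf_den \<psi> - rf_num \<psi> * rf_den \<phi>"
  have "D \<noteq> 0"
  proof
    assume "D = 0"
    hence "Fract (rf_num \<phi>) (rf_den \<phi>) = Fract (rf_num \<psi>) (rf_den \<psi>)"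
      by (simp add: D_def eq_fract)
    thus False using assms by (simp add: rf_Fract_num_den)
  qed
  hence "finite {z. poly D z = 0}" by (rule poly_roots_finite)
  moreover have "{x. rf_eval \<phi> x = rf_eval \<psi> x} \<subseteq> insert Infinity (Affine ` {z. poly D z = 0})"
  proof
    fix x assume x: "x \<in> {x. rf_eval \<phi> x = rf_eval \<psi> x}"
    show "x \<in> insert Infinity (Affine ` {z. poly D z = 0})"
    proof (cases x)
      case (Affine z)
      thus ?thesis using x by (auto simp: D_def frac_eq_eq split: if_splits)
    qed simp
  qed
  ultimately show ?thesis using finite_subset by blast
qed

lemma preperiodicI_finite:
  assumes "finite S" "\<And>k. (F ^^ k) x \<in> S"
  shows "preperiodic F x"
proof -
  have "\<not> inj (\<lambda>k. (F ^^ k) x)"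
  proof
    assume "inj (\<lambda>k. (F ^^ k) x)"
    moreover have "range (\<lambda>k. (F ^^ k) x) \<subseteq> S" using assms(2) by auto
    ultimately show False using assms(1) finite_subset infinite_UNIV_nat finite_imageD by blast
  qed
  thus ?thesis unfolding inj_def preperiodic_def by (metis linorder_neqE_nat)
qed

lemma preperiodic_transfer:
  fixes F G :: "'b \<Rightarrow> 'b"
  assumes comm: "\<And>k x. (F ^^ (a + r)) ((G ^^ k) x) = (F ^^ a) ((G ^^ k) ((F ^^ r) x))"
    and r: "r > 0"
    and fin: "\<And>m n. m \<noteq> n \<Longrightarrow> finite {x. (F ^^ m) x = (F ^^ n) x}"
    and x: "preperiodic F x"
  shows "preperiodic G x"
proof -
  \<comment> \<open>Blocks of \<open>r\<close> applications of \<open>F\<close> move across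
    \<open>G ^^ k\<close> one at a time, while the outermost \<open>a\<close> stay in place.\<close>
  have comm': "(F ^^ (a + n * r)) ((G ^^ k) x) = (F ^^ a) ((G ^^ k) ((F ^^ (n * r)) x))" for n k x
  proof (induction n arbitrary: x)
    case (Suc n)
    have "(F ^^ (a + Suc n * r)) ((G ^^ k) x) = (F ^^ (n * r)) ((F ^^ (a + r)) ((G ^^ k) x))"
      using funpow_add[of "n * r" "a + r" F] by (simp add: add_ac)
    also have "\<dots> = (F ^^ (a + n * r)) ((G ^^ k) ((F ^^ r) x))"
      unfolding comm using funpow_add[of "n * r" a F] by (simp add: add.commute)
    also have "\<dots> = (F ^^ a) ((G ^^ k) ((F ^^ (Suc n * r)) x))"
      unfolding Suc using funpow_add[of "n * r" r F] by (simp add: add.commute)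
    finally show ?case .
  qed simp
  obtain m n where mn: "m < n" "(F ^^ m) x = (F ^^ n) x" using x by (auto simp: preperiodic_def)
  define p where "p = n - m"
  have p: "(F ^^ (i + j * p)) x = (F ^^ i) x" if "i \<ge> m" for i j
  proof (induction j)
    case (Suc j)
    have "i + Suc j * p = (i - m + j * p) + n" using that mn(1) by (simp add: p_def)
    hence "(F ^^ (i + Suc j * p)) x = (F ^^ (i - m + j * p)) ((F ^^ n) x)"
      by (simp only: funpow_add[of "i - m + j * p" n] comp_apply)
    also have "\<dots> = (F ^^ (i - m + j * p + m)) x"
      by (simp only: funpow_add[of "i - m + j * p" m] comp_apply mn(2))
    also have "\<dots> = (F ^^ (i + j * p)) x" using that by simp
    finally show ?case using Suc by simp
  qed simp
  \<comment> \<open>Both exponents are \<open>a\<close> plus a multiple of \<open>r\<close>, so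
    \<open>comm'\<close> applies. As \<open>m * r \<ge> m\<close> and \<open>p * r\<close> is a
    multiple of the period \<open>p\<close>, the inner iterates of \<open>x\<close> agree, whence
    membership for every \<open>k\<close>.\<close>
  define S where "S = {y. (F ^^ (a + (m + p) * r)) y = (F ^^ (a + m * r)) y}"
  have "(G ^^ k) x \<in> S" for k
  proof -
    have "(F ^^ ((m + p) * r)) x = (F ^^ (m * r)) x"
      using p[of "m * r" r] r by (simp add: algebra_simps)
    thus ?thesis unfolding S_def by (simp add: comm')
  qed
  moreover have "finite S" unfolding S_def using mn(1) r by (intro fin) (simp add: p_def)
  ultimately show ?thesis by (intro preperiodicI_finite[of S])
qed

section \<open>Inclusion of preperiodic sets, and freeness\<close>

lemma Prep_subset:
  fixes f g :: "'a::field ratfun"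
  assumes nc: "rf_nonconstant f" "rf_nonconstant g"
    and fixed: "rf_eval (to_ac_rf f) \<alpha> = \<alpha>" "rf_eval (to_ac_rf g) \<alpha> = \<alpha>"
    and e: "rf_e (to_ac_rf f) \<alpha> > 1" "rf_e (to_ac_rf g) \<alpha> > 1"
      "\<not> CHAR('a) dvd rf_e (to_ac_rf f) \<alpha>" "\<not> CHAR('a) dvd rf_e (to_ac_rf g) \<alpha>"
    and rel: "comp_word f g u = comp_word f g v" "u \<noteq> v"
  shows "Prep f \<subseteq> Prep g"
proof -
  let ?F = "to_ac_rf f" and ?G = "to_ac_rf g"
  have nc': "rf_nonconstant ?F" "rf_nonconstant ?G"
    using nc by (simp_all add: rf_nonconstant_to_ac_rf)
  have "comp_word ?F ?G u = comp_word ?F ?G v"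
    using rel(1) by (simp flip: to_ac_rf_comp_word[OF nc])
  \<comment> \<open>The closure has the same characteristic, so non-divisibility says that the
    exponents are nonzero in it.\<close>
  then obtain a r where ar: "r > 0"
    "\<And>k. comp_word ?F ?G (replicate (a + r) True @ replicate k False) =
          comp_word ?F ?G (replicate a True @ replicate k False @ replicate r True)"
    "inj (\<lambda>n. comp_word ?F ?G (replicate n True))"
    using comp_word_relation[OF nc' fixed e(1,2), of u v] e(3,4) rel(2)
    unfolding of_nat_eq_0_iff_char_dvd CHAR_alg_closure by blast
  note eval = rf_eval_comp_word[OF nc'] foldr_append foldr_replicate_funpow
  show ?thesis
  proof
    fix x assume "x \<in> Prep f"
    hence x: "preperiodic (rf_eval ?F) x" by (simp add: Prep_def)
    have "preperiodic (rf_eval ?G) x"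
    proof (rule preperiodic_transfer[OF _ ar(1) _ x])
      fix k y
      show "(rf_eval ?F ^^ (a + r)) ((rf_eval ?G ^^ k) y) = (rf_eval ?F ^^ a) ((rf_eval ?G ^^ k) ((rf_eval ?F ^^ r) y))"
        using arg_cong[OF ar(2)[of k], of "\<lambda>\<phi>. rf_eval \<phi> y"] by (simp add: eval)
    next
      fix m n :: nat assume "m \<noteq> n"
      hence "comp_word ?F ?G (replicate m True) \<noteq> comp_word ?F ?G (replicate n True)"
        using ar(3) by (auto dest: injD)
      from finite_rf_eval_eq[OF this] show "finite {y. (rf_eval ?F ^^ m) y = (rf_eval ?F ^^ n) y}"
        by (simp add: eval)
    qed
    thus "x \<in> Prep g" by (simp add: Prep_def)
  qed
qed

text \<open>Turns a relation for \<open>f\<close>, \<open>g\<close> into one for \<open>g\<close>,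
  \<open>f\<close>, so that the inclusion can be used both ways.\<close>

lemma comp_word_swap: "comp_word g f (map Not w) = comp_word f g w"
  by (induction w) auto

theorem theorem5p6:
  fixes f g :: "'a::field ratfun"
    and \<alpha> :: "'a alg_closure P1"
  assumes "rf_nonconstant f" and "rf_nonconstant g"
    and "rf_eval (to_ac_rf f) \<alpha> = \<alpha>" and "rf_eval (to_ac_rf g) \<alpha> = \<alpha>"
    and "rf_e (to_ac_rf f) \<alpha> > 1" and "rf_e (to_ac_rf g) \<alpha> > 1"
    and "\<not> CHAR('a) dvd rf_e (to_ac_rf f) \<alpha>"
    and "\<not> CHAR('a) dvd rf_e (to_ac_rf g) \<alpha>"
    and "Prep f \<noteq> Prep g"
  shows "free_comp_semigroup f g"
proof -
  have "u = v" if rel: "comp_word f g u = comp_word f g v" for u v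
  proof (rule ccontr)
    assume neq: "u \<noteq> v"
    have "Prep f \<subseteq> Prep g" using Prep_subset[OF assms(1-8) rel neq] .
    moreover have "Prep g \<subseteq> Prep f"
    proof (rule Prep_subset[OF assms(2,1,4,3,6,5,8,7)])
      show "comp_word g f (map Not u) = comp_word g f (map Not v)" by (simp add: comp_word_swap rel)
      have "inj Not" by (simp add: inj_def)
      thus "map Not u \<noteq> map Not v" using neq by (simp add: inj_map_eq_map)
    qed
    ultimately show False using assms(9) by blast
  qed
  thus ?thesis
    using comp_word_image[OF assms(1,2)]
    by (auto simp: free_comp_semigroup_def bij_betw_def inj_on_def)
qed

end
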